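(* Let $G$ be a unimodular transitive graph with vertex set $V$ and with degree $d$. Suppose that $X_v$, $v\in V$, is an $\mathrm{Aut}(G)$-factor-of-IID process with a finite state space. Then for an arbitrary $o\in V$ we have $$\frac12\sum_{o'\sim o}H(X_o,X_{o'})\ \ge\ \beta\,H(X_o),\qquad\text{where}\quad \beta=\frac12\left(d+\inf_{W\subset V;\ |W|<\infty}\frac{|\partial W|}{|W|}\right).$$ Here $o'$ runs through all neighbors of the fixed vertex $o$ in $G$.
   Context: Graphs here are connected and infinite, with finite degree $d$. $G$ is transitive if its automorphism group $\mathrm{Aut}(G)$ acts transitively on $V$. A transitive $G$ is unimodular if the Mass-Transport Principle holds: $\sum_{v\in V}h(o,v)=\sum_{v\in V}h(v,o)$ for any fixed $o\in V$ and any $h:V\times V\to[0,\infty)$ that is diagonally $\mathrm{Aut}(G)$-invariant (i.e. $h(\varphi(u),\varphi(v))=h(u,v)$ for all $\varphi\in\mathrm{Aut}(G)$, $u,v\in V$); equivalently, $|\mathrm{Stab}(u)v|=|\mathrm{Stab}(v)u|$ for all $u,v\in V$, where $\mathrm{Stab}(u)$ is the stabilizer of $u$ in $\mathrm{Aut}(G)$. An $\mathrm{Aut}(G)$-factor-of-IID process with state space $M$ is a collection of random variables $X=(X_v)_{v\in V}$ of the form $X=F(Z)$, where $Z=(Z_v)_{v\in V}$ are independent uniform $[0,1]$ random variables and $F:[0,1]^V\to M^V$ is measurable and $\mathrm{Aut}(G)$-equivariant. $H$ denotes Shannon entropy ($\sum_j -p_j\log p_j$), and $H(X_o,X_{o'})$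 is the entropy of the joint distribution. $\partial W$ is the set of edges with exactly one endpoint in $W$; the infimum is over nonempty finite $W$. *)

theory Defs
  imports "HOL-Probability.Probability"
begin

text \<open>
  A simple graph is an edge relation \<open>E\<close> on the type \<open>'v\<close>; the vertex set is the whole type.
\<close>

definition simple_graph :: "('v \<Rightarrow> 'v \<Rightarrow> bool) \<Rightarrow> bool" where
  "simple_graph E \<longleftrightarrow> symp E \<and> irreflp E"

definition connected_graph :: "('v \<Rightarrow> 'v \<Rightarrow> bool) \<Rightarrow> bool" where
  "connected_graph E \<longleftrightarrow> (\<forall>u v. E\<^sup>*\<^sup>* u v)"

definition neighbors :: "('v \<Rightarrow> 'v \<Rightarrow> bool) \<Rightarrow> 'v \<Rightarrow> 'v set" where
  "neighbors E u = {v. E u v}"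

definition regular_graph :: "('v \<Rightarrow> 'v \<Rightarrow> bool) \<Rightarrow> nat \<Rightarrow> bool" where
  "regular_graph E d \<longleftrightarrow> (\<forall>v. finite (neighbors E v) \<and> card (neighbors E v) = d)"

definition Aut :: "('v \<Rightarrow> 'v \<Rightarrow> bool) \<Rightarrow> ('v \<Rightarrow> 'v) set" where
  "Aut E = {\<phi>. bij \<phi> \<and> (\<forall>u v. E (\<phi> u) (\<phi> v) \<longleftrightarrow> E u v)}"

definition transitive_graph :: "('v \<Rightarrow> 'v \<Rightarrow> bool) \<Rightarrow> bool" where
  "transitive_graph E \<longleftrightarrow> (\<forall>u v. \<exists>\<phi>\<in>Aut E. \<phi> u = v)"

text \<open>
  Unimodularity is the Mass-Transport Principle. The transport \<open>h\<close> has finite nonnegative values,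
  but the sums may be infinite, so they are taken in \<^typ>\<open>ennreal\<close>.
\<close>

definition unimodular_graph :: "('v \<Rightarrow> 'v \<Rightarrow> bool) \<Rightarrow> bool" where
  "unimodular_graph E \<longleftrightarrow>
    (\<forall>u (h :: 'v \<Rightarrow> 'v \<Rightarrow> real).
      (\<forall>x y. 0 \<le> h x y) \<longrightarrow>
      (\<forall>\<phi>\<in>Aut E. \<forall>x y. h (\<phi> x) (\<phi> y) = h x y) \<longrightarrow>
      (\<Sum>\<^sub>\<infinity>v. ennreal (h u v)) = (\<Sum>\<^sub>\<infinity>v. ennreal (h v u)))"

definition edge_boundary :: "('v \<Rightarrow> 'v \<Rightarrow> bool) \<Rightarrow> 'v set \<Rightarrow> 'v set set" where
  "edge_boundary E W = {{u, v} | u v. E u v \<and> u \<in> W \<and> v \<notin> W}"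

definition isoperimetric_const :: "('v \<Rightarrow> 'v \<Rightarrow> bool) \<Rightarrow> real" where
  "isoperimetric_const E =
    (INF W\<in>{W. finite W \<and> W \<noteq> {}}. real (card (edge_boundary E W)) / real (card W))"

definition shift :: "('v \<Rightarrow> 'v) \<Rightarrow> ('v \<Rightarrow> 'a) \<Rightarrow> 'v \<Rightarrow> 'a" where
  "shift \<phi> x = (\<lambda>v. x (inv \<phi> v))"

definition unit_interval :: "real measure" where
  "unit_interval = restrict_space lborel {0..1}"

definition equivariant_on ::
    "('v \<Rightarrow> 'v \<Rightarrow> bool) \<Rightarrow> ('v \<Rightarrow> 'a) set \<Rightarrow> (('v \<Rightarrow> 'a) \<Rightarrow> 'v \<Rightarrow> 'b) \<Rightarrow> bool" where
  "equivariant_on E A F \<longleftrightarrow> (\<forall>\<phi>\<in>Aut E. \<forall>z\<in>A. F (shift \<phi> z) = shift \<phi> (F z))"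

definition factor_of_iid ::
    "('v \<Rightarrow> 'v \<Rightarrow> bool) \<Rightarrow> 'w measure \<Rightarrow> 's set \<Rightarrow> ('v \<Rightarrow> 'w \<Rightarrow> 's) \<Rightarrow> bool" where
  "factor_of_iid E M S X \<longleftrightarrow>
    (\<exists>(Z :: 'v \<Rightarrow> 'w \<Rightarrow> real) F.
      prob_space.indep_vars M (\<lambda>_. unit_interval) Z UNIV \<and>
      (\<forall>v. distr M unit_interval (Z v) = unit_interval) \<and>
      F \<in> (\<Pi>\<^sub>M v\<in>UNIV. unit_interval) \<rightarrow>\<^sub>M (\<Pi>\<^sub>M v\<in>UNIV. count_space S) \<and>
      equivariant_on E (UNIV \<rightarrow> {0..1}) F \<and>
      (\<forall>\<omega>\<in>space M. \<forall>v. X v \<omega> = F (\<lambda>u. Z u \<omega>) v))"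

abbreviation shannon_entropy :: "'w measure \<Rightarrow> real \<Rightarrow> ('w \<Rightarrow> 's) \<Rightarrow> real" where
  "shannon_entropy M b Y \<equiv> prob_space.entropy M b (count_space (Y ` space M)) Y"

lemma (in information_space) shannon_entropy_eq:
  assumes "finite S" and "Y \<in> M \<rightarrow>\<^sub>M count_space S"
  shows "shannon_entropy M b Y =
    - (\<Sum>y\<in>Y ` space M. prob {\<omega> \<in> space M. Y \<omega> = y} * log b (prob {\<omega> \<in> space M. Y \<omega> = y}))"
proof -
  have sub: "Y ` space M \<subseteq> S"
    using measurable_space[OF assms(2)] by auto
  have "simple_function M Y"
    unfolding simple_function_def
  proof
    show "finite (Y ` space M)"
      using sub assms(1) by (rule finite_subset)
    show "\<forall>y\<in>Y ` space M. Y -` {y} \<inter> space M \<in> sets M"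
      using sub measurable_sets[OF assms(2)] by auto
  qed
  then have "simple_distributed M Y (\<lambda>y. prob (Y -` {y} \<inter> space M))"
    by (intro simple_distributedI) auto
  then show ?thesis
    by (subst entropy_simple_distributed) (auto simp: vimage_def Int_def conj_commute)
qed

end

theory Submission
  imports Defs
begin

text \<open>
  Each vertex pays for its entropy with the seeds, and the payments are transported through the
  graph.

  Reveal the seeds one after another in a random order. The expected amount by which the revelation
  of the seed at \<open>k\<close> decreases the entropy of \<open>X v\<close> is a number \<open>f k v \<ge> 0\<close>. It is the Shapley
  value of the player \<open>k\<close> in the game that assigns to a set \<open>A\<close> of seeds the information which
  \<open>A\<close> carries about \<open>X v\<close>. Three facts are needed.

  \<^item> The shares of all seeds in \<open>X v\<close> add up to the entropy of \<open>X v\<close>, up to an arbitrarily small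
    error (\<open>sum_shapley\<close>, \<open>entropy_given_readout_small\<close>).
  \<^item> The share of \<open>k\<close> in a pair \<open>(X v, X w)\<close> is at least \<open>max (f k v) (f k w)\<close>, because for
    independent seeds the information gained from \<open>k\<close> only grows when the target is
    refined or when more seeds are already known (\<open>gain_mono\<close>). So the sum of these maxima over all
    \<open>k\<close> is at most the entropy of the pair (\<open>sum_max_shapley_le_entropy_Pair\<close>).
  \<^item> The number \<open>f k v\<close> is invariant under the diagonal action of the automorphisms
    (\<open>shapley_permute\<close>), since the process is equivariant and the law of the seeds is exchangeable.
    The order needs no additional randomness: the values of the seeds serve as arrival times,
    while the gains themselves are deterministic functions of the set of earlier seeds.

  By the mass-transport principle it suffices to fix the seed \<open>k\<close> and to let the vertex vary. For
  a finitely supported \<open>f \<ge> 0\<close> on the vertices, cutting \<open>f\<close> into its level sets \<open>W\<close> gives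
  \<open>\<Sum>v. \<Sum>w \<sim> v. max (f v) (f w) \<ge> (d + h) * (\<Sum>v. f v)\<close> with the isoperimetric constant \<open>h\<close>,
  because exactly \<open>d * card W\<close> plus the size of the boundary many ordered edges meet \<open>W\<close>
  (\<open>isoperimetric_sum_max\<close>). Transporting back gives the entropies of the edges at a fixed vertex on
  the left and the entropy of that vertex on the right.

  To stay within Shannon entropy of finitely many values, the process is examined through a finite
  window of seeds, each of them replaced by a function of the seed with finitely many values. The
  window is a ball around the vertex, hence it moves along with the automorphisms. Only the first of
  the three facts suffers from this, by an error that vanishes in the limit.
\<close>

section \<open>Shannon entropy of random variables with finitely many values\<close>

lemma simple_function_count_space_finite:
  assumes "f \<in> N \<rightarrow>\<^sub>M count_space S" "finite S"
  shows "simple_function N f"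
  unfolding simple_function_def
proof
  show "finite (f ` space N)"
    using measurable_space[OF assms(1)] assms(2) by (auto intro: finite_subset)
  show "\<forall>y\<in>f ` space N. f -` {y} \<inter> space N \<in> sets N"
    using measurable_space[OF assms(1)] measurable_sets[OF assms(1)] by auto
qed

text \<open>
  The convention \<open>0 * log b 0 = 0\<close> of entropy is the continuous one; at the other points the function
  is a product of continuous functions.
\<close>

lemma continuous_on_times_log:
  fixes b :: real
  shows "continuous_on {0..} (\<lambda>x. x * log b x)"
proof -
  have "continuous (at x within {0..}) (\<lambda>x. x * log b x)" if "0 \<le> x" for x :: real
  proof (cases "x = 0")
    case True
    have "((\<lambda>x::real. x * ln x) \<longlongrightarrow> 0) (at_right 0)"
      by real_asymp
    then have "((\<lambda>x::real. x * ln x / ln b) \<longlongrightarrow> 0 / ln b) (at_right 0)"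
      unfolding divide_inverse by (intro tendsto_intros)
    moreover have "at 0 within {0..} = at_right (0::real)"
      by (metis at_within_Ici_at_right)
    ultimately show ?thesis
      using True by (simp add: continuous_within log_def)
  next
    case False
    with that show ?thesis
      unfolding log_def divide_inverse by (intro continuous_intros) auto
  qed
  then show ?thesis
    by (auto simp: continuous_on_eq_continuous_within)
qed

context information_space
begin

text \<open>
  Written as an expectation, an entropy \<open>- \<integral> log b (p (Y \<omega>)) \<partial>M\<close> no longer refers to the range of \<open>Y\<close>,
  so that entropies of different marginals can be added without summing out variables.
\<close>

lemma sum_prob_simple_function_eq_integral:
  fixes h :: "'b \<Rightarrow> real"
  assumes "simple_function M Y"
  shows "(\<Sum>y\<in>Y ` space M. prob (Y -` {y} \<inter> space M) * h y) = (\<integral>\<omega>. h (Y \<omega>) \<partial>M)"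
proof -
  note Y = simple_functionD[OF assms]
  have "(\<integral>\<omega>. h (Y \<omega>) \<partial>M) =
    (\<integral>\<omega>. (\<Sum>y\<in>Y ` space M. indicator (Y -` {y} \<inter> space M) \<omega> * h y) \<partial>M)"
  proof (intro Bochner_Integration.integral_cong refl)
    fix \<omega> assume \<omega>: "\<omega> \<in> space M"
    have "(\<Sum>y\<in>Y ` space M. indicator (Y -` {y} \<inter> space M) \<omega> * h y) =
      (\<Sum>y\<in>Y ` space M. if y = Y \<omega> then h y else 0)"
      using \<omega> by (intro sum.cong) (auto simp: indicator_def)
    with \<omega> Y(1) show "h (Y \<omega>) = (\<Sum>y\<in>Y ` space M. indicator (Y -` {y} \<inter> space M) \<omega> * h y)"
      by simp
  qed
  also have "\<dots> = (\<Sum>y\<in>Y ` space M. prob (Y -` {y} \<inter> space M) * h y)"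
    using Y by (subst Bochner_Integration.integral_sum)
      (auto intro!: integrable_mult_left simp: emeasure_eq_measure)
  finally show ?thesis ..
qed

lemma integrable_simple_function_compose:
  fixes h :: "'b \<Rightarrow> real"
  assumes "simple_function M Y"
  shows "integrable M (\<lambda>\<omega>. h (Y \<omega>))"
proof (rule integrable_const_bound)
  have sf: "simple_function M (\<lambda>\<omega>. h (Y \<omega>))"
    using simple_function_compose1[OF assms] .
  show "(\<lambda>\<omega>. h (Y \<omega>)) \<in> borel_measurable M"
    using sf by (rule borel_measurable_simple_function)
  show "AE \<omega> in M. norm (h (Y \<omega>)) \<le> Max ((\<lambda>y. norm (h y)) ` Y ` space M)"
    using simple_functionD(1)[OF assms] by (intro AE_I2) (auto intro!: Max_ge)
qed

lemma entropy_eq_sum: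
  assumes "simple_function M Y" "finite B" "Y ` space M \<subseteq> B"
  shows "\<H>(Y) = - (\<Sum>y\<in>B. prob (Y -` {y} \<inter> space M) * log b (prob (Y -` {y} \<inter> space M)))"
proof -
  have 0: "Y -` {y} \<inter> space M = {}" if "y \<notin> Y ` space M" for y
    using that by auto
  have "\<H>(Y) = - (\<Sum>y\<in>Y ` space M. prob (Y -` {y} \<inter> space M) * log b (prob (Y -` {y} \<inter> space M)))"
    using simple_distributedI[OF assms(1) measure_nonneg refl]
    by (rule entropy_simple_distributed)
  also have "(\<Sum>y\<in>Y ` space M. prob (Y -` {y} \<inter> space M) * log b (prob (Y -` {y} \<inter> space M))) =
    (\<Sum>y\<in>B. prob (Y -` {y} \<inter> space M) * log b (prob (Y -` {y} \<inter> space M)))"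
    using assms by (intro sum.mono_neutral_left) (auto simp: 0)
  finally show ?thesis .
qed

lemma entropy_eq_integral:
  assumes "simple_function M Y"
  shows "\<H>(Y) = - (\<integral>\<omega>. log b (prob (Y -` {Y \<omega>} \<inter> space M)) \<partial>M)"
  using entropy_eq_sum[OF assms simple_functionD(1)[OF assms] order_refl]
    sum_prob_simple_function_eq_integral[OF assms, of "\<lambda>y. log b (prob (Y -` {y} \<inter> space M))"]
  by simp

lemma entropy_cong_distr:
  assumes "simple_function M Y" "simple_function M Y'"
    and "\<And>y. prob (Y -` {y} \<inter> space M) = prob (Y' -` {y} \<inter> space M)"
  shows "\<H>(Y) = \<H>(Y')"
proof -
  have "finite (Y ` space M \<union> Y' ` space M)"
    using assms(1,2) by (auto dest: simple_functionD)
  then show ?thesis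
    using assms by (subst (1 2) entropy_eq_sum[where B = "Y ` space M \<union> Y' ` space M"]) auto
qed

lemma prob_simple_vimage_mono:
  assumes "simple_function M Y" "simple_function M Y'"
    and "\<And>\<omega>. \<omega> \<in> space M \<Longrightarrow> Y \<omega> = y \<Longrightarrow> Y' \<omega> = y'"
  shows "prob (Y -` {y} \<inter> space M) \<le> prob (Y' -` {y'} \<inter> space M)"
  using assms simple_functionD(2)[OF assms(2)] by (intro finite_measure_mono) auto

lemma entropy_const: "\<H>(\<lambda>\<omega>. c) = 0"
proof -
  have "(\<lambda>\<omega>. c) -` {c} \<inter> space M = space M"
    by auto
  then show ?thesis
    by (subst entropy_eq_sum[where B = "{c}"]) (auto simp: prob_space)
qed

text \<open>
  Together with the nonnegativity of conditional mutual information this is the submodularity of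
  entropy, the information inequality on which the argument rests. The logarithm of the quotient splits
  on the support of the joint law, and outside of it the weight is zero.
\<close>

lemma conditional_mutual_information_eq_entropies:
  assumes X: "simple_function M X" and Y: "simple_function M Y" and Z: "simple_function M Z"
  shows "\<I>(X ; Y | Z) =
    \<H>(\<lambda>\<omega>. (X \<omega>, Z \<omega>)) + \<H>(\<lambda>\<omega>. (Y \<omega>, Z \<omega>)) - \<H>(\<lambda>\<omega>. (X \<omega>, Y \<omega>, Z \<omega>)) - \<H>(Z)"
proof -
  define pz where "pz z = prob (Z -` {z} \<inter> space M)" for z
  define pxz where "pxz x = prob ((\<lambda>\<omega>. (X \<omega>, Z \<omega>)) -` {x} \<inter> space M)" for x
  define pyz where "pyz x = prob ((\<lambda>\<omega>. (Y \<omega>, Z \<omega>)) -` {x} \<inter> space M)" for x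
  define pxyz where "pxyz x = prob ((\<lambda>\<omega>. (X \<omega>, Y \<omega>, Z \<omega>)) -` {x} \<inter> space M)" for x
  note XZ = simple_function_Pair[OF X Z]
  note YZ = simple_function_Pair[OF Y Z]
  note XYZ = simple_function_Pair[OF X YZ]
  let ?T = "\<lambda>\<omega>. (X \<omega>, Y \<omega>, Z \<omega>)"
  let ?L = "\<lambda>(x, y, z). log b (pxyz (x, y, z)) + log b (pz z) - log b (pxz (x, z)) - log b (pyz (y, z))"
  have le: "pxyz (x, y, z) \<le> pz z" "pxyz (x, y, z) \<le> pxz (x, z)" "pxyz (x, y, z) \<le> pyz (y, z)"
    for x y z
    unfolding pxyz_def pz_def pxz_def pyz_def
    by (auto intro!: prob_simple_vimage_mono[OF XYZ Z] prob_simple_vimage_mono[OF XYZ XZ]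
        prob_simple_vimage_mono[OF XYZ YZ])
  have "\<I>(X ; Y | Z) = (\<Sum>(x, y, z)\<in>?T ` space M.
      pxyz (x, y, z) * log b (pxyz (x, y, z) / (pxz (x, z) * (pyz (y, z) / pz z))))"
    using simple_distributedI[OF Z measure_nonneg refl] simple_distributedI[OF YZ measure_nonneg refl]
      simple_distributedI[OF XZ measure_nonneg refl] simple_distributedI[OF XYZ measure_nonneg refl]
    unfolding pz_def pxz_def pyz_def pxyz_def
    by (rule conditional_mutual_information_eq)
  also have "\<dots> = (\<Sum>t\<in>?T ` space M. pxyz t * ?L t)"
  proof (intro sum.cong refl)
    fix t
    assume "t \<in> ?T ` space M"
    obtain x y z where t: "t = (x, y, z)"
      by (cases t)
    have "pxyz (x, y, z) * log b (pxyz (x, y, z) / (pxz (x, z) * (pyz (y, z) / pz z))) =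
      pxyz (x, y, z) * ?L (x, y, z)"
    proof (cases "pxyz (x, y, z) = 0")
      case False
      then have "0 < pxyz (x, y, z)"
        by (simp add: pxyz_def zero_less_measure_iff)
      then have "0 < pxyz (x, y, z)" "0 < pz z" "0 < pxz (x, z)" "0 < pyz (y, z)"
        using le[of x y z] by linarith+
      then show ?thesis
        using b_gt_1 by (simp add: log_divide log_mult)
    qed simp
    then show "(case t of (x, y, z) \<Rightarrow>
        pxyz (x, y, z) * log b (pxyz (x, y, z) / (pxz (x, z) * (pyz (y, z) / pz z)))) = pxyz t * ?L t"
      unfolding t by simp
  qed
  also have "\<dots> = (\<integral>\<omega>. ?L (?T \<omega>) \<partial>M)"
    unfolding pxyz_def by (rule sum_prob_simple_function_eq_integral[OF XYZ])
  also have "\<dots> = (\<integral>\<omega>. log b (pxyz (X \<omega>, Y \<omega>, Z \<omega>)) + log b (pz (Z \<omega>))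
      - log b (pxz (X \<omega>, Z \<omega>)) - log b (pyz (Y \<omega>, Z \<omega>)) \<partial>M)"
    by simp
  also have "\<dots> = (\<integral>\<omega>. log b (pxyz (X \<omega>, Y \<omega>, Z \<omega>)) \<partial>M) + (\<integral>\<omega>. log b (pz (Z \<omega>)) \<partial>M)
      - (\<integral>\<omega>. log b (pxz (X \<omega>, Z \<omega>)) \<partial>M) - (\<integral>\<omega>. log b (pyz (Y \<omega>, Z \<omega>)) \<partial>M)"
    using integrable_simple_function_compose[OF XYZ, of "\<lambda>x. log b (pxyz x)"]
      integrable_simple_function_compose[OF XZ, of "\<lambda>x. log b (pxz x)"]
      integrable_simple_function_compose[OF YZ, of "\<lambda>x. log b (pyz x)"]
      integrable_simple_function_compose[OF Z, of "\<lambda>x. log b (pz x)"]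
    by simp
  also have "\<dots> = \<H>(\<lambda>\<omega>. (X \<omega>, Z \<omega>)) + \<H>(\<lambda>\<omega>. (Y \<omega>, Z \<omega>)) - \<H>(\<lambda>\<omega>. (X \<omega>, Y \<omega>, Z \<omega>)) - \<H>(Z)"
    unfolding entropy_eq_integral[OF XZ] entropy_eq_integral[OF YZ] entropy_eq_integral[OF Z]
      entropy_eq_integral[OF XYZ] pxyz_def pxz_def pyz_def pz_def by simp
  finally show ?thesis .
qed

text \<open>
  Used throughout to rearrange tuples of random variables and to identify random variables that agree
  on the sample space.
\<close>

lemma entropy_recode:
  assumes "simple_function M Y"
    and "\<And>\<omega>. \<omega> \<in> space M \<Longrightarrow> Y' \<omega> = f (Y \<omega>)" and "inj_on f (Y ` space M)"
  shows "\<H>(Y') = \<H>(Y)"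
proof -
  have im: "Y' ` space M = (f \<circ> Y) ` space M"
    using assms(2) by auto
  have sf: "simple_function M (f \<circ> Y)"
    using assms(1) by (rule simple_function_compose)
  moreover have "simple_function M Y'"
    using sf simple_function_cong[of M Y' "f \<circ> Y"] assms(2) by simp
  ultimately have "\<H>(Y') = \<H>(f \<circ> Y)"
    using assms(2) by (intro entropy_cong_distr arg_cong[where f = prob]) auto
  then show ?thesis
    using entropy_of_inj[OF assms(1,3)] by simp
qed

lemma entropy_le_entropy_Pair:
  assumes "simple_function M X" "simple_function M Y"
  shows "\<H>(Y) \<le> \<H>(\<lambda>\<omega>. (X \<omega>, Y \<omega>))"
  using entropy_data_processing[OF simple_function_Pair[OF assms], of snd] by (simp add: comp_def)

lemma entropy_Pair_le:
  assumes X: "simple_function M X" and Y: "simple_function M Y"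
  shows "\<H>(\<lambda>\<omega>. (X \<omega>, Y \<omega>)) \<le> \<H>(X) + \<H>(Y)"
  using entropy_chain_rule[OF X Y] conditional_entropy_less_eq_entropy[OF Y X] by simp

text \<open>
  The difference is the conditional entropy of \<open>K\<close> given \<open>T\<close>: conditioning on a finer variable
  decreases it. This is submodularity for \<open>K\<close> and \<open>T'\<close> over \<open>T\<close>, where \<open>T\<close> is absorbed by \<open>T'\<close>.
\<close>

lemma entropy_increment_antimono:
  assumes K: "simple_function M K" and T': "simple_function M T'"
    and T: "\<And>\<omega>. \<omega> \<in> space M \<Longrightarrow> T \<omega> = g (T' \<omega>)"
  shows "\<H>(\<lambda>\<omega>. (K \<omega>, T' \<omega>)) - \<H>(T') \<le> \<H>(\<lambda>\<omega>. (K \<omega>, T \<omega>)) - \<H>(T)"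
proof -
  have sT: "simple_function M T"
    using simple_function_compose1[OF T', of g] simple_function_cong[of M T "\<lambda>\<omega>. g (T' \<omega>)"] T by simp
  note KT' = simple_function_Pair[OF K T']
  have "\<H>(\<lambda>\<omega>. (K \<omega>, T' \<omega>, T \<omega>)) = \<H>(\<lambda>\<omega>. (K \<omega>, T' \<omega>))"
    using T by (intro entropy_recode[OF KT', where f = "\<lambda>(k, t). (k, t, g t)"]) (auto simp: inj_on_def)
  moreover have "\<H>(\<lambda>\<omega>. (T' \<omega>, T \<omega>)) = \<H>(T')"
    using T by (intro entropy_recode[OF T', where f = "\<lambda>t. (t, g t)"]) (auto simp: inj_on_def)
  ultimately show ?thesis
    using conditional_mutual_information_nonneg[OF K T' sT]
      conditional_mutual_information_eq_entropies[OF K T' sT] by simp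
qed

lemma entropy_Pair_indep:
  assumes K: "simple_function M K" and T: "simple_function M T"
    and indep: "\<And>k t. prob ((\<lambda>\<omega>. (K \<omega>, T \<omega>)) -` {(k, t)} \<inter> space M) =
      prob (K -` {k} \<inter> space M) * prob (T -` {t} \<inter> space M)"
  shows "\<H>(\<lambda>\<omega>. (K \<omega>, T \<omega>)) = \<H>(K) + \<H>(T)"
proof -
  define pk where "pk k = prob (K -` {k} \<inter> space M)" for k
  define pt where "pt t = prob (T -` {t} \<inter> space M)" for t
  let ?P = "\<lambda>\<omega>. (K \<omega>, T \<omega>)"
  note KT = simple_function_Pair[OF K T]
  let ?L = "\<lambda>(k, t). log b (pk k) + log b (pt t)"
  have "\<H>(?P) = - (\<Sum>y\<in>?P ` space M. prob (?P -` {y} \<inter> space M) * log b (prob (?P -` {y} \<inter> space M)))"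
    by (intro entropy_eq_sum[OF KT simple_functionD(1)[OF KT]]) simp
  also have "(\<Sum>y\<in>?P ` space M. prob (?P -` {y} \<inter> space M) * log b (prob (?P -` {y} \<inter> space M))) =
    (\<Sum>y\<in>?P ` space M. prob (?P -` {y} \<inter> space M) * ?L y)"
  proof (intro sum.cong refl)
    fix y
    assume "y \<in> ?P ` space M"
    obtain k t where y: "y = (k, t)"
      by (cases y)
    show "prob (?P -` {y} \<inter> space M) * log b (prob (?P -` {y} \<inter> space M)) =
      prob (?P -` {y} \<inter> space M) * ?L y"
      unfolding y indep using b_gt_1
      by (cases "pk k = 0 \<or> pt t = 0") (auto simp: pk_def pt_def log_mult zero_less_measure_iff)
  qed
  also have "\<dots> = (\<integral>\<omega>. ?L (?P \<omega>) \<partial>M)"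
    by (rule sum_prob_simple_function_eq_integral[OF KT])
  also have "\<dots> = (\<integral>\<omega>. log b (pk (K \<omega>)) \<partial>M) + (\<integral>\<omega>. log b (pt (T \<omega>)) \<partial>M)"
    using integrable_simple_function_compose[OF K, of "\<lambda>x. log b (pk x)"]
      integrable_simple_function_compose[OF T, of "\<lambda>x. log b (pt x)"] by simp
  finally show ?thesis
    unfolding entropy_eq_integral[OF K] entropy_eq_integral[OF T] pk_def pt_def by simp
qed

text \<open>
  When the values stay in a fixed finite set, closeness in probability makes the finitely many
  point masses converge, and entropy is a continuous function of these.
\<close>

lemma tendsto_entropy:
  fixes Y :: "nat \<Rightarrow> 'a \<Rightarrow> 'c"
  assumes Y: "\<And>n. simple_function M (Y n)" and Y': "simple_function M Y'"
    and "finite B" "\<And>n. Y n ` space M \<subseteq> B" "Y' ` space M \<subseteq> B"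
    and lim: "(\<lambda>n. prob {\<omega> \<in> space M. Y n \<omega> \<noteq> Y' \<omega>}) \<longlonglongrightarrow> 0"
  shows "(\<lambda>n. \<H>(Y n)) \<longlonglongrightarrow> \<H>(Y')"
proof -
  have "(\<lambda>n. prob (Y n -` {y} \<inter> space M)) \<longlonglongrightarrow> prob (Y' -` {y} \<inter> space M)" for y
  proof (rule LIM_zero_cancel, rule Lim_null_comparison[OF _ lim], intro always_eventually allI)
    fix n
    have m: "Y n -` {y} \<inter> space M \<in> events" "Y' -` {y} \<inter> space M \<in> events"
      using simple_functionD[OF Y] simple_functionD[OF Y'] by auto
    have ne: "{\<omega> \<in> space M. Y n \<omega> \<noteq> Y' \<omega>} \<in> events"
    proof -
      have "{\<omega> \<in> space M. Y n \<omega> \<noteq> Y' \<omega>} =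
        (\<lambda>\<omega>. (Y n \<omega>, Y' \<omega>)) -` {p. fst p \<noteq> snd p} \<inter> space M"
        by auto
      also have "\<dots> \<in> events"
        by (rule simple_functionD(2)[OF simple_function_Pair[OF Y Y']])
      finally show ?thesis .
    qed
    let ?N = "{\<omega> \<in> space M. Y n \<omega> \<noteq> Y' \<omega>}"
    have "prob (Y n -` {y} \<inter> space M) \<le> prob (Y' -` {y} \<inter> space M \<union> ?N)"
      using m ne by (intro finite_measure_mono) auto
    moreover have "prob (Y' -` {y} \<inter> space M) \<le> prob (Y n -` {y} \<inter> space M \<union> ?N)"
      using m ne by (intro finite_measure_mono) auto
    moreover have "prob (Y' -` {y} \<inter> space M \<union> ?N) \<le> prob (Y' -` {y} \<inter> space M) + prob ?N"
      "prob (Y n -` {y} \<inter> space M \<union> ?N) \<le> prob (Y n -` {y} \<inter> space M) + prob ?N"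
      using m ne by (auto intro!: measure_Un_le)
    ultimately show "norm (prob (Y n -` {y} \<inter> space M) - prob (Y' -` {y} \<inter> space M)) \<le> prob ?N"
      by auto
  qed
  then have "(\<lambda>n. prob (Y n -` {y} \<inter> space M) * log b (prob (Y n -` {y} \<inter> space M)))
    \<longlonglongrightarrow> prob (Y' -` {y} \<inter> space M) * log b (prob (Y' -` {y} \<inter> space M))" for y
    by (intro continuous_on_tendsto_compose[OF continuous_on_times_log]) auto
  then show ?thesis
    unfolding entropy_eq_sum[OF Y assms(3,4)] entropy_eq_sum[OF Y' assms(3,5)]
    by (intro tendsto_minus tendsto_sum)
qed

end

section \<open>Isoperimetry and mass transport on the graph\<close>

lemma inv_in_Aut:
  assumes "\<phi> \<in> Aut E"
  shows "inv \<phi> \<in> Aut E"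
proof -
  have "bij \<phi>" and iff: "\<And>u v. E (\<phi> u) (\<phi> v) \<longleftrightarrow> E u v"
    using assms by (auto simp: Aut_def)
  have "E (inv \<phi> u) (inv \<phi> v) \<longleftrightarrow> E u v" for u v
    using iff[of "inv \<phi> u" "inv \<phi> v"] \<open>bij \<phi>\<close> by (simp add: bij_is_surj surj_f_inv_f)
  with \<open>bij \<phi>\<close> show ?thesis
    by (simp add: Aut_def bij_imp_bij_inv)
qed

definition graph_ball :: "('v \<Rightarrow> 'v \<Rightarrow> bool) \<Rightarrow> nat \<Rightarrow> 'v \<Rightarrow> 'v set" where
  "graph_ball E n v = {w. \<exists>i\<le>n. (E ^^ i) v w}"

lemma graph_ball_mono: "m \<le> n \<Longrightarrow> graph_ball E m v \<subseteq> graph_ball E n v"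
  unfolding graph_ball_def using order_trans by blast

lemma graph_ball_Suc: "w \<in> graph_ball E n v \<Longrightarrow> E w x \<Longrightarrow> x \<in> graph_ball E (Suc n) v"
  unfolding graph_ball_def by (blast intro: relpowp_Suc_I Suc_le_mono[THEN iffD2])

lemma finite_graph_ball:
  assumes "\<And>v. finite (neighbors E v)"
  shows "finite (graph_ball E n v)"
proof -
  have "finite {w. (E ^^ i) v w}" for i
  proof (induction i)
    case (Suc i)
    have "{w. (E ^^ Suc i) v w} = (\<Union>u\<in>{w. (E ^^ i) v w}. neighbors E u)"
      by (auto simp: neighbors_def)
    with Suc assms show ?case
      by simp
  qed simp
  moreover have "graph_ball E n v = (\<Union>i\<le>n. {w. (E ^^ i) v w})"
    by (auto simp: graph_ball_def)
  ultimately show ?thesis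
    by simp
qed

lemma graph_ball_commute:
  assumes "symp E"
  shows "w \<in> graph_ball E n v \<longleftrightarrow> v \<in> graph_ball E n w"
proof -
  have "(E ^^ i) v w \<Longrightarrow> (E ^^ i) w v" for i v w
  proof (induction i arbitrary: v w)
    case (Suc i)
    then obtain y where "(E ^^ i) v y" "E y w"
      by (auto elim: relpowp_Suc_E)
    then have "E w y" "(E ^^ i) y v"
      using Suc.IH assms by (auto dest: sympD)
    then show ?case
      by (rule relpowp_Suc_I2)
  qed simp
  then show ?thesis
    by (auto simp: graph_ball_def)
qed

lemma finite_subset_graph_ball:
  assumes "connected_graph E" "finite D"
  shows "\<exists>n. D \<subseteq> graph_ball E n v"
  using assms(2)
proof (induction D)
  case (insert w D)
  then obtain n where n: "D \<subseteq> graph_ball E n v"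
    by auto
  obtain m where m: "(E ^^ m) v w"
    using assms(1) unfolding connected_graph_def rtranclp_power by blast
  have "insert w D \<subseteq> graph_ball E (max m n) v"
    using n m graph_ball_mono[of n "max m n" E v] by (auto simp: graph_ball_def)
  then show ?case ..
qed simp

lemma graph_ball_Aut:
  assumes "\<phi> \<in> Aut E"
  shows "graph_ball E n (\<phi> v) = \<phi> ` graph_ball E n v"
proof -
  have "bij \<phi>" and iff: "\<And>u v. E (\<phi> u) (\<phi> v) \<longleftrightarrow> E u v"
    using assms by (auto simp: Aut_def)
  have pow: "(E ^^ i) (\<phi> v) (\<phi> w) \<longleftrightarrow> (E ^^ i) v w" for i w
  proof (induction i arbitrary: w)
    case 0
    show ?case
      using \<open>bij \<phi>\<close> by (simp add: bij_def inj_eq)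
  next
    case (Suc i)
    have "(E ^^ Suc i) (\<phi> v) (\<phi> w) \<longleftrightarrow> (\<exists>x. (E ^^ i) (\<phi> v) (\<phi> x) \<and> E (\<phi> x) (\<phi> w))"
      using bij_is_surj[OF \<open>bij \<phi>\<close>] by (auto simp: relcompp_apply) (metis surjD)
    then show ?case
      by (auto simp: Suc iff)
  qed
  show ?thesis
  proof (intro set_eqI)
    fix w
    obtain x where "w = \<phi> x"
      using bij_is_surj[OF \<open>bij \<phi>\<close>] by (metis surjD)
    then show "w \<in> graph_ball E n (\<phi> v) \<longleftrightarrow> w \<in> \<phi> ` graph_ball E n v"
      using bij_is_inj[OF \<open>bij \<phi>\<close>] by (simp add: inj_image_mem_iff) (simp add: graph_ball_def pow)
  qed
qed

lemma neighbors_Aut: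
  assumes "\<phi> \<in> Aut E"
  shows "neighbors E (\<phi> v) = \<phi> ` neighbors E v"
proof (intro set_eqI)
  fix w
  have "bij \<phi>" and iff: "\<And>u v. E (\<phi> u) (\<phi> v) \<longleftrightarrow> E u v"
    using assms by (auto simp: Aut_def)
  obtain x where "w = \<phi> x"
    using bij_is_surj[OF \<open>bij \<phi>\<close>] by (metis surjD)
  then show "w \<in> neighbors E (\<phi> v) \<longleftrightarrow> w \<in> \<phi> ` neighbors E v"
    using bij_is_inj[OF \<open>bij \<phi>\<close>] by (simp add: inj_image_mem_iff neighbors_def iff)
qed

lemma isoperimetric_const_nonneg: "0 \<le> isoperimetric_const E"
  unfolding isoperimetric_const_def by (intro cINF_greatest) auto

lemma isoperimetric_const_le:
  assumes "finite W"
  shows "isoperimetric_const E * card W \<le> card (edge_boundary E W)"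
proof (cases "W = {}")
  case False
  with assms have "isoperimetric_const E \<le> real (card (edge_boundary E W)) / real (card W)"
    unfolding isoperimetric_const_def by (intro cINF_lower bdd_belowI2[where m = 0]) auto
  with assms False show ?thesis
    by (simp add: pos_le_divide_eq card_gt_0_iff)
qed simp

text \<open>
  The right-hand side counts ordered edges that meet \<open>W\<close>: \<open>d\<close> of them start at each vertex of \<open>W\<close>, and
  each boundary edge contributes one more, which starts outside of \<open>W\<close>.
\<close>

lemma isoperimetric_count:
  assumes "simple_graph E" "regular_graph E d" "finite W" "finite N"
    and N: "\<And>v w. v \<in> W \<Longrightarrow> E v w \<Longrightarrow> w \<in> N" and "W \<subseteq> N"
  shows "(d + isoperimetric_const E) * card W \<le>
    (\<Sum>v\<in>N. \<Sum>w\<in>neighbors E v. of_bool (v \<in> W \<or> w \<in> W))"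
proof -
  have fin: "finite (neighbors E v)" and deg: "card (neighbors E v) = d" for v
    using assms(2) by (auto simp: regular_graph_def)
  have E_sym: "E v w \<longleftrightarrow> E w v" for v w
    using assms(1) by (auto simp: simple_graph_def sympD)
  let ?B = "SIGMA v : N - W. neighbors E v \<inter> W"
  have "edge_boundary E W = (\<lambda>(v, w). {v, w}) ` ?B"
  proof (intro equalityI subsetI)
    fix e assume "e \<in> edge_boundary E W"
    then obtain u v where e: "e = {v, u}" "E v u" "u \<in> W" "v \<notin> W"
      using E_sym by (auto simp: edge_boundary_def insert_commute)
    then have "(v, u) \<in> ?B"
      using N[of u v] E_sym by (auto simp: neighbors_def)
    then show "e \<in> (\<lambda>(v, w). {v, w}) ` ?B"
      using e(1) by (intro image_eqI[where x = "(v, u)"]) auto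
  next
    fix e assume "e \<in> (\<lambda>(v, w). {v, w}) ` ?B"
    then obtain v w where "e = {w, v}" "E w v" "w \<in> W" "v \<notin> W"
      using E_sym by (auto simp: neighbors_def insert_commute)
    then show "e \<in> edge_boundary E W"
      unfolding edge_boundary_def by blast
  qed
  moreover have "inj_on (\<lambda>(v, w). {v, w}) ?B"
    by (auto simp: inj_on_def doubleton_eq_iff)
  ultimately have boundary: "card (edge_boundary E W) = card ?B"
    by (simp add: card_image)
  have "(\<Sum>v\<in>N. \<Sum>w\<in>neighbors E v. of_bool (v \<in> W \<or> w \<in> W)) =
    (\<Sum>v\<in>W. \<Sum>w\<in>neighbors E v. of_bool (v \<in> W \<or> w \<in> W)) +
    (\<Sum>v\<in>N - W. \<Sum>w\<in>neighbors E v. of_bool (v \<in> W \<or> w \<in> W) :: real)"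
    using assms by (subst sum.subset_diff[of W N]) auto
  also have "(\<Sum>v\<in>W. \<Sum>w\<in>neighbors E v. of_bool (v \<in> W \<or> w \<in> W) :: real) = d * card W"
    by (simp add: deg)
  also have "(\<Sum>v\<in>N - W. \<Sum>w\<in>neighbors E v. of_bool (v \<in> W \<or> w \<in> W) :: real) =
      (\<Sum>v\<in>N - W. card (neighbors E v \<inter> W))"
    unfolding of_nat_sum
  proof (intro sum.cong refl)
    fix v assume "v \<in> N - W"
    then have "(\<Sum>w\<in>neighbors E v. of_bool (v \<in> W \<or> w \<in> W) :: real) =
        (\<Sum>w\<in>neighbors E v. of_bool (w \<in> W))"
      by simp
    also have "\<dots> = card (neighbors E v \<inter> W)"
      using fin by (simp add: Int_def)
    finally show "(\<Sum>w\<in>neighbors E v. of_bool (v \<in> W \<or> w \<in> W) :: real) = card (neighbors E v \<inter> W)" .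
  qed
  also have "(\<Sum>v\<in>N - W. card (neighbors E v \<inter> W)) = card ?B"
    using assms fin by (subst card_SigmaI) auto
  finally show ?thesis
    using isoperimetric_const_le[OF \<open>finite W\<close>, of E] boundary by (simp add: algebra_simps)
qed

text \<open>
  A discrete co-area inequality. For the indicator of a finite set it is the previous count. In
  general, \<open>f\<close> is peeled from below: subtracting its smallest positive value on its whole
  support lowers each maximum over an edge that meets the support by this same value, and shrinks the
  support.
\<close>

lemma isoperimetric_sum_max:
  fixes f :: "'v \<Rightarrow> real"
  assumes "simple_graph E" "regular_graph E d" "finite N"
    and "\<And>v. 0 \<le> f v"
    and "\<And>v. f v \<noteq> 0 \<Longrightarrow> v \<in> N" "\<And>v w. f v \<noteq> 0 \<Longrightarrow> E v w \<Longrightarrow> w \<in> N"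
  shows "(d + isoperimetric_const E) * (\<Sum>v\<in>N. f v) \<le>
    (\<Sum>v\<in>N. \<Sum>w\<in>neighbors E v. max (f v) (f w))"
  using assms(4-6)
proof (induction "card {v. f v \<noteq> 0}" arbitrary: f rule: less_induct)
  case less
  define W where "W = {v. f v \<noteq> 0}"
  have "W \<subseteq> N"
    using less.prems(2) by (auto simp: W_def)
  with \<open>finite N\<close> have "finite W"
    by (rule finite_subset[rotated])
  show ?case
  proof (cases "W = {}")
    case True
    then show ?thesis
      by (simp add: W_def)
  next
    case False
    \<comment> \<open>The height of the lowest layer of \<open>f\<close>.\<close>
    define m where "m = Min (f ` W)"
    have "m \<in> f ` W"
      unfolding m_def using \<open>finite W\<close> False by (intro Min_in) auto
    then obtain v0 where v0: "v0 \<in> W" "f v0 = m"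
      by auto
    have m_le: "m \<le> f v" if "v \<in> W" for v
      unfolding m_def using that \<open>finite W\<close> by (intro Min_le) auto
    have "0 < m"
      using v0 less.prems(1)[of v0] by (auto simp: W_def)
    define g where "g v = f v - m * of_bool (v \<in> W)" for v
    have g0: "0 \<le> g v" for v
      using m_le less.prems(1) by (auto simp: g_def)
    have "f v = 0" if "v \<notin> W" for v
      using that by (simp add: W_def)
    then have "g v = 0" if "v \<notin> W" for v
      using that by (simp add: g_def)
    moreover have "g v0 = 0"
      using v0 by (simp add: g_def)
    ultimately have supp: "{v. g v \<noteq> 0} \<subset> W"
      using v0(1) by blast
    then have "card {v. g v \<noteq> 0} < card {v. f v \<noteq> 0}"
      using \<open>finite W\<close> by (fold W_def) (rule psubset_card_mono)
    moreover have "v \<in> N" "E v w \<Longrightarrow> w \<in> N" if "g v \<noteq> 0" for v w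
    proof -
      have "f v \<noteq> 0"
        using supp that by (auto simp: W_def)
      then show "v \<in> N" "E v w \<Longrightarrow> w \<in> N"
        using less.prems(2,3) by auto
    qed
    ultimately have IH: "(d + isoperimetric_const E) * (\<Sum>v\<in>N. g v) \<le>
        (\<Sum>v\<in>N. \<Sum>w\<in>neighbors E v. max (g v) (g w))"
      using g0 by (intro less.hyps)
    have count: "(d + isoperimetric_const E) * card W \<le>
        (\<Sum>v\<in>N. \<Sum>w\<in>neighbors E v. of_bool (v \<in> W \<or> w \<in> W))"
      using assms(1-3) \<open>finite W\<close> \<open>W \<subseteq> N\<close> less.prems(3)
      by (intro isoperimetric_count) (auto simp: W_def)
    have "(\<Sum>v\<in>N. f v) = (\<Sum>v\<in>N. g v) + m * (\<Sum>v\<in>N. of_bool (v \<in> W))"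
      by (simp add: g_def sum_subtractf sum_distrib_left)
    also have "(\<Sum>v\<in>N. of_bool (v \<in> W)) = real (card W)"
      using \<open>finite N\<close> \<open>W \<subseteq> N\<close> by (simp add: Int_absorb1 Int_def[symmetric])
    finally have "(d + isoperimetric_const E) * (\<Sum>v\<in>N. f v) =
        (d + isoperimetric_const E) * (\<Sum>v\<in>N. g v) + m * ((d + isoperimetric_const E) * card W)"
      by (simp add: algebra_simps)
    also have "\<dots> \<le> (\<Sum>v\<in>N. \<Sum>w\<in>neighbors E v. max (g v) (g w)) +
        m * (\<Sum>v\<in>N. \<Sum>w\<in>neighbors E v. of_bool (v \<in> W \<or> w \<in> W))"
      using IH count \<open>0 < m\<close> by (intro add_mono mult_left_mono) auto
    also have "\<dots> = (\<Sum>v\<in>N. \<Sum>w\<in>neighbors E v. max (g v) (g w) + m * of_bool (v \<in> W \<or> w \<in> W))"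
      by (simp add: sum.distrib sum_distrib_left)
    also have "\<dots> = (\<Sum>v\<in>N. \<Sum>w\<in>neighbors E v. max (f v) (f w))"
    proof (intro sum.cong refl)
      fix v w
      have "f v = 0" if "v \<notin> W" for v
        using that by (simp add: W_def)
      then show "max (g v) (g w) + m * of_bool (v \<in> W \<or> w \<in> W) = max (f v) (f w)"
        using m_le[of v] m_le[of w] \<open>0 < m\<close> by (cases "v \<in> W"; cases "w \<in> W") (auto simp: g_def max_def)
    qed
    finally show ?thesis .
  qed
qed

text \<open>
  The form in which the mass-transport principle is applied: all transport to and from \<open>u\<close> stays in a
  finite set, so the sums are real numbers.
\<close>

lemma mass_transport_finite:
  fixes h :: "'v \<Rightarrow> 'v \<Rightarrow> real"
  assumes "unimodular_graph E" and "\<And>x y. 0 \<le> h x y"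
    and "\<And>\<phi> x y. \<phi> \<in> Aut E \<Longrightarrow> h (\<phi> x) (\<phi> y) = h x y"
    and "finite A" "\<And>v. v \<notin> A \<Longrightarrow> h u v = 0 \<and> h v u = 0"
  shows "(\<Sum>v\<in>A. h u v) = (\<Sum>v\<in>A. h v u)"
proof -
  have "(\<Sum>\<^sub>\<infinity>v. ennreal (h u v)) = (\<Sum>\<^sub>\<infinity>v. ennreal (h v u))"
    using assms(1-3) unfolding unimodular_graph_def by blast
  moreover have "(\<Sum>\<^sub>\<infinity>v. ennreal (h u v)) = (\<Sum>\<^sub>\<infinity>v\<in>A. ennreal (h u v))"
    "(\<Sum>\<^sub>\<infinity>v. ennreal (h v u)) = (\<Sum>\<^sub>\<infinity>v\<in>A. ennreal (h v u))"
    using assms(5) by (auto intro!: infsum_cong_neutral)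
  ultimately have "(\<Sum>v\<in>A. ennreal (h u v)) = (\<Sum>v\<in>A. ennreal (h v u))"
    using \<open>finite A\<close> by simp
  then have "ennreal (\<Sum>v\<in>A. h u v) = ennreal (\<Sum>v\<in>A. h v u)"
    using assms(2) by (simp add: sum_ennreal)
  then show ?thesis
    using assms(2) by (subst (asm) ennreal_inj) (auto intro: sum_nonneg)
qed

section \<open>Approximating functions of infinitely many coordinates\<close>

text \<open>
  A total function with default value \<open>0\<close> outside of the window \<open>D\<close>, so that readouts over
  different windows have the same type.
\<close>

definition readout :: "('a \<Rightarrow> nat) \<Rightarrow> 'v set \<Rightarrow> ('v \<Rightarrow> 'a) \<Rightarrow> 'v \<Rightarrow> nat" where
  "readout q D z = (\<lambda>k. if k \<in> D then q (z k) else 0)"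

definition finite_coding :: "'a measure \<Rightarrow> ('a \<Rightarrow> nat) \<Rightarrow> bool" where
  "finite_coding N q \<longleftrightarrow> q \<in> N \<rightarrow>\<^sub>M count_space UNIV \<and> finite (range q)"

lemma readout_refine:
  assumes "D \<subseteq> D'"
  shows "readout (h \<circ> q) D z = (\<lambda>k. if k \<in> D then h (readout q D' z k) else 0)"
  using assms by (auto simp: readout_def fun_eq_iff)

lemma simple_function_readout:
  fixes N :: "'a measure" and D :: "'v set"
  assumes "finite_coding N q" "finite D"
  shows "simple_function (\<Pi>\<^sub>M v\<in>UNIV. N) (readout q D)"
  unfolding simple_function_def
proof (intro conjI ballI)
  let ?P = "\<Pi>\<^sub>M v\<in>(UNIV :: 'v set). N"
  have q: "q \<in> N \<rightarrow>\<^sub>M count_space UNIV" and fin: "finite (range q)"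
    using assms(1) by (auto simp: finite_coding_def)
  show "finite (readout q D ` space ?P)"
    by (rule finite_subset[OF _ finite_set_of_finite_funs[OF assms(2) fin, of 0]])
      (auto simp: readout_def)
  fix f
  have "(\<lambda>z. q (z k)) \<in> ?P \<rightarrow>\<^sub>M count_space UNIV" for k
    by (rule measurable_compose[OF measurable_component_singleton[of k UNIV "\<lambda>_. N"] q]) simp
  then have "{z \<in> space ?P. q (z k) = f k} \<in> sets ?P" for k
    using measurable_sets[of "\<lambda>z. q (z k)" ?P "count_space UNIV" "{f k}"]
    by (simp add: vimage_def Int_def conj_commute)
  then have "{z \<in> space ?P. \<forall>k\<in>D. q (z k) = f k} \<in> sets ?P"
    using assms(2) by (intro sets.sets_Collect_finite_All) auto
  moreover have "readout q D -` {f} \<inter> space ?P =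
    (if \<forall>k. k \<notin> D \<longrightarrow> f k = 0 then {z \<in> space ?P. \<forall>k\<in>D. q (z k) = f k} else {})"
    by (auto simp: readout_def fun_eq_iff)
  ultimately show "readout q D -` {f} \<inter> space ?P \<in> sets ?P"
    by simp
qed

definition approximable :: "'a measure \<Rightarrow> ('a \<Rightarrow> nat) \<Rightarrow> 'v set \<Rightarrow> real \<Rightarrow> ('v \<Rightarrow> 'a) set \<Rightarrow> bool" where
  "approximable N q D e B \<longleftrightarrow> (\<exists>C. measure (\<Pi>\<^sub>M v\<in>UNIV. N)
    {z \<in> space (\<Pi>\<^sub>M v\<in>UNIV. N). (z \<in> B) \<noteq> (readout q D z \<in> C)} \<le> e)"

lemma approximable_refine:
  assumes "approximable N (h \<circ> q) D e B" "D \<subseteq> D'"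
  shows "approximable N q D' e B"
proof -
  obtain C where C: "measure (\<Pi>\<^sub>M v\<in>UNIV. N)
      {z \<in> space (\<Pi>\<^sub>M v\<in>UNIV. N). (z \<in> B) \<noteq> (readout (h \<circ> q) D z \<in> C)} \<le> e"
    using assms(1) by (auto simp: approximable_def)
  define C' where "C' = {f. (\<lambda>k. if k \<in> D then h (f k) else 0) \<in> C}"
  have "readout (h \<circ> q) D z \<in> C \<longleftrightarrow> readout q D' z \<in> C'" for z
    unfolding readout_refine[OF assms(2)] C'_def by simp
  with C show ?thesis
    unfolding approximable_def by auto
qed

text \<open>
  Finitely many windows have a common union, and finitely many codings a common refinement by pairing.
\<close>

lemma approximable_family:
  fixes \<B> :: "('v \<Rightarrow> 'a) set set"
  assumes "finite \<B>"
    and "\<And>B. B \<in> \<B> \<Longrightarrow> \<exists>q D. finite_coding N q \<and> finite D \<and> approximable N q D e B"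
  shows "\<exists>q D. finite_coding N q \<and> finite D \<and> (\<forall>B\<in>\<B>. approximable N q D e B)"
  using assms
proof (induction \<B>)
  case empty
  have "finite_coding N (\<lambda>_. 0)"
    by (simp add: finite_coding_def)
  then show ?case
    by auto
next
  case (insert B \<B>)
  obtain q1 D1 where 1: "finite_coding N q1" "finite D1" "\<forall>B\<in>\<B>. approximable N q1 D1 e B"
    using insert by auto
  obtain q2 D2 where 2: "finite_coding N q2" "finite D2" "approximable N q2 D2 e B"
    using insert.prems[of B] by blast
  define q where "q x = prod_encode (q1 x, q2 x)" for x
  have q1: "q1 = (fst \<circ> prod_decode) \<circ> q" and q2: "q2 = (snd \<circ> prod_decode) \<circ> q"
    by (auto simp: q_def)
  have "(\<lambda>x. (q1 x, q2 x)) \<in> N \<rightarrow>\<^sub>M count_space UNIV \<Otimes>\<^sub>M count_space UNIV"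
    using 1(1) 2(1) by (intro measurable_Pair) (auto simp: finite_coding_def)
  then have "(\<lambda>x. (q1 x, q2 x)) \<in> N \<rightarrow>\<^sub>M count_space UNIV"
    by (simp add: pair_measure_countable)
  then have "q \<in> N \<rightarrow>\<^sub>M count_space UNIV"
    unfolding q_def by (rule measurable_compose) simp
  moreover have "finite (range q)"
    using 1(1) 2(1) unfolding finite_coding_def q_def
    by (intro finite_subset[OF _ finite_imageI[of "range q1 \<times> range q2" prod_encode]]) auto
  ultimately have "finite_coding N q"
    by (simp add: finite_coding_def)
  moreover have "finite (D1 \<union> D2)"
    using 1 2 by simp
  moreover have "approximable N q (D1 \<union> D2) e B'" if "B' \<in> insert B \<B>" for B'
  proof (cases "B' = B")
    case True
    then show ?thesis
      using 2(3) q2 by (intro approximable_refine[of N "snd \<circ> prod_decode" q D2]) auto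
  next
    case False
    then show ?thesis
      using that 1(3) q1 by (intro approximable_refine[of N "fst \<circ> prod_decode" q D1]) auto
  qed
  ultimately show ?case
    by blast
qed

lemma sets_readout_approximation:
  fixes N :: "'a measure" and B :: "('v \<Rightarrow> 'a) set"
  assumes "finite_coding N q" "finite D" "B \<in> sets (\<Pi>\<^sub>M v\<in>UNIV. N)"
  shows "{z \<in> space (\<Pi>\<^sub>M v\<in>UNIV. N). (z \<in> B) \<noteq> (readout q D z \<in> C)} \<in> sets (\<Pi>\<^sub>M v\<in>UNIV. N)"
proof -
  let ?P = "\<Pi>\<^sub>M v\<in>UNIV :: 'v set. N"
  define R where "R = readout q D -` C \<inter> space ?P"
  have "R \<in> sets ?P"
    unfolding R_def using simple_functionD(2)[OF simple_function_readout[OF assms(1,2)]] .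
  moreover have "{z \<in> space ?P. (z \<in> B) \<noteq> (readout q D z \<in> C)} = (B - R) \<union> (R - B)"
    using sets.sets_into_space[OF assms(3)] by (auto simp: R_def)
  ultimately show ?thesis
    using assms(3) by auto
qed

text \<open>
  Approximable events form a \<open>\<sigma>\<close>-algebra that contains the cylinders over a single coordinate; for
  those, the indicator of the base is itself a coding. A countable union is first
  replaced by a finite one.
\<close>

lemma approximable_sets:
  fixes N :: "'a measure" and B :: "('v \<Rightarrow> 'a) set"
  assumes "prob_space N" and "B \<in> sets (\<Pi>\<^sub>M v\<in>UNIV. N)" and "0 < e"
  shows "\<exists>q D. finite_coding N q \<and> finite D \<and> approximable N q D e B"
proof -
  let ?P = "\<Pi>\<^sub>M v\<in>UNIV :: 'v set. N"
  interpret P: prob_space ?P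
    using assms(1) by (intro prob_space_PiM)
  let ?G = "{{f \<in> \<Pi>\<^sub>E i\<in>UNIV. space N. f i \<in> A} | (i :: 'v) A. i \<in> UNIV \<and> A \<in> sets N}"
  have "B \<in> sigma_sets (\<Pi>\<^sub>E i\<in>UNIV. space N) ?G"
    using assms(2) by (simp add: sets_PiM_single)
  then show ?thesis
    using assms(3)
  proof (induction arbitrary: e)
    case (Basic B)
    then obtain i A where B: "B = {f \<in> \<Pi>\<^sub>E i\<in>UNIV. space N. f i \<in> A}" and A: "A \<in> sets N"
      by auto
    define q :: "'a \<Rightarrow> nat" where "q x = (if x \<in> A then 1 else 0)" for x
    have "q \<in> N \<rightarrow>\<^sub>M count_space UNIV"
      unfolding q_def using A by (intro measurable_If_set) auto
    moreover have "finite (range q)"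
      by (rule finite_subset[of _ "{0, 1}"]) (auto simp: q_def)
    moreover have exact: "{z \<in> space ?P. (z \<in> B) \<noteq> (readout q {i} z \<in> {f. f i = 1})} = {}"
      by (auto simp: B readout_def q_def space_PiM split: if_splits)
    have "approximable N q {i} e B"
      unfolding approximable_def using Basic.prems
      by (intro exI[of _ "{f. f i = 1}"], subst exact) simp
    ultimately show ?case
      unfolding finite_coding_def by blast
  next
    case Empty
    have "approximable N (\<lambda>_. 0) {} e ({} :: ('v \<Rightarrow> 'a) set)"
      unfolding approximable_def using Empty by (intro exI[of _ "{}"]) simp
    moreover have "finite_coding N (\<lambda>_. 0)"
      by (simp add: finite_coding_def)
    ultimately show ?case
      by blast
  next
    case (Compl B)
    then obtain q D C where qD: "finite_coding N q" "finite D"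
      and C: "measure ?P {z \<in> space ?P. (z \<in> B) \<noteq> (readout q D z \<in> C)} \<le> e"
      unfolding approximable_def by meson
    have compl: "{z \<in> space ?P. (z \<in> (\<Pi>\<^sub>E i\<in>UNIV. space N) - B) \<noteq> (readout q D z \<in> - C)} =
        {z \<in> space ?P. (z \<in> B) \<noteq> (readout q D z \<in> C)}"
      by (auto simp: space_PiM)
    have "approximable N q D e ((\<Pi>\<^sub>E i\<in>UNIV. space N) - B)"
      unfolding approximable_def using C by (intro exI[of _ "- C"], subst compl)
    with qD show ?case
      by blast
  next
    case (Union B)
    have B: "B i \<in> sets ?P" for i
      using Union.hyps by (simp add: sets_PiM_single)
    define A where "A n = (\<Union>i<n. B i)" for n
    have A: "A n \<in> sets ?P" for n
      using B by (auto simp: A_def)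
    have "incseq A"
      unfolding A_def by (intro monoI UN_mono) auto
    then have "(\<lambda>n. P.prob (A n)) \<longlonglongrightarrow> P.prob (\<Union>n. A n)"
      using A by (intro P.finite_Lim_measure_incseq) auto
    moreover have UA: "(\<Union>n. A n) = (\<Union>i. B i)"
      by (auto simp: A_def)
    ultimately have "\<forall>\<^sub>F n in sequentially. P.prob (\<Union>i. B i) - e / 2 < P.prob (A n)"
      using Union.prems by (intro order_tendstoD(1)[where y = "P.prob (\<Union>i. B i)"]) auto
    then obtain n where "P.prob (\<Union>i. B i) - e / 2 < P.prob (A n)"
      by (auto dest: eventually_happens)
    moreover have "P.prob ((\<Union>i. B i) - A n) = P.prob (\<Union>i. B i) - P.prob (A n)"
      using A B UA by (intro P.finite_measure_Diff) auto
    ultimately have n: "P.prob ((\<Union>i. B i) - A n) < e / 2"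
      by simp
    \<comment> \<open>One half of the error is spent on the truncation, the other half on the \<open>n\<close> remaining events.\<close>
    define e' where "e' = e / (2 * (real n + 1))"
    have "0 < e'"
      using Union.prems by (simp add: e'_def)
    have "\<exists>q D. finite_coding N q \<and> finite D \<and> (\<forall>B'\<in>B ` {..<n}. approximable N q D e' B')"
      using Union.IH \<open>0 < e'\<close> by (intro approximable_family) auto
    then obtain q D where qD: "finite_coding N q" "finite D" "\<forall>i<n. approximable N q D e' (B i)"
      by auto
    then have "\<forall>i\<in>{..<n}. \<exists>C. P.prob {z \<in> space ?P. (z \<in> B i) \<noteq> (readout q D z \<in> C)} \<le> e'"
      unfolding approximable_def by blast
    from bchoice[OF this] obtain C where C: "\<And>i. i < n \<Longrightarrow>
        P.prob {z \<in> space ?P. (z \<in> B i) \<noteq> (readout q D z \<in> C i)} \<le> e'"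
      by blast
    let ?N = "\<lambda>i. {z \<in> space ?P. (z \<in> B i) \<noteq> (readout q D z \<in> C i)}"
    have N: "?N i \<in> sets ?P" for i
      using sets_readout_approximation[OF qD(1,2) B] .
    have "P.prob {z \<in> space ?P. (z \<in> (\<Union>i. B i)) \<noteq> (readout q D z \<in> (\<Union>i<n. C i))} \<le>
        P.prob (((\<Union>i. B i) - A n) \<union> (\<Union>i<n. ?N i))"
      using A B N by (intro P.finite_measure_mono) (auto simp: A_def)
    also have "\<dots> \<le> P.prob ((\<Union>i. B i) - A n) + P.prob (\<Union>i<n. ?N i)"
      using A B N by (intro measure_Un_le) auto
    also have "P.prob (\<Union>i<n. ?N i) \<le> (\<Sum>i<n. P.prob (?N i))"
      using N by (intro P.finite_measure_subadditive_finite) auto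
    also have "\<dots> \<le> real n * e'"
      using C sum_bounded_above[of "{..<n}" "\<lambda>i. P.prob (?N i)" e'] by simp
    also have "\<dots> \<le> e / 2"
      using Union.prems by (simp add: e'_def field_simps)
    finally have "approximable N q D e (\<Union>i. B i)"
      unfolding approximable_def using n by (intro exI[of _ "\<Union>i<n. C i"]) simp
    with qD(1,2) show ?case
      by blast
  qed
qed

text \<open>
  All level sets of \<open>F\<close> are approximated through one readout. Where none of these approximations
  fails, exactly one of them contains the readout, and it reveals the value of \<open>F\<close>.
\<close>

lemma measurable_approximable:
  fixes N :: "'a measure" and F :: "('v \<Rightarrow> 'a) \<Rightarrow> 's"
  assumes "prob_space N" and F: "F \<in> (\<Pi>\<^sub>M v\<in>UNIV. N) \<rightarrow>\<^sub>M count_space S" and "finite S" and "0 < e"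
  shows "\<exists>q D g. finite_coding N q \<and> finite D \<and> range g \<subseteq> S \<and>
    measure (\<Pi>\<^sub>M v\<in>UNIV. N) {z \<in> space (\<Pi>\<^sub>M v\<in>UNIV. N). F z \<noteq> g (readout q D z)} \<le> e"
proof -
  let ?P = "\<Pi>\<^sub>M v\<in>UNIV :: 'v set. N"
  interpret P: prob_space ?P
    using assms(1) by (intro prob_space_PiM)
  have FS: "F z \<in> S" if "z \<in> space ?P" for z
    using measurable_space[OF F that] by simp
  then obtain s0 where "s0 \<in> S"
    using P.not_empty by blast
  define B where "B s = F -` {s} \<inter> space ?P" for s
  have B: "B s \<in> sets ?P" if "s \<in> S" for s
    unfolding B_def using that by (intro measurable_sets[OF F]) simp
  \<comment> \<open>The additional \<open>1\<close> only serves to keep the denominator visibly positive.\<close>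
  define e' where "e' = e / (real (card S) + 1)"
  have "0 < e'"
    using assms(4) by (simp add: e'_def add_nonneg_pos)
  have "\<exists>q D. finite_coding N q \<and> finite D \<and> (\<forall>B'\<in>B ` S. approximable N q D e' B')"
    using approximable_sets[OF assms(1) _ \<open>0 < e'\<close>] B assms(3)
    by (intro approximable_family) auto
  then obtain q D where qD: "finite_coding N q" "finite D" "\<forall>s\<in>S. approximable N q D e' (B s)"
    by auto
  then have "\<forall>s\<in>S. \<exists>C. P.prob {z \<in> space ?P. (z \<in> B s) \<noteq> (readout q D z \<in> C)} \<le> e'"
    unfolding approximable_def by blast
  from bchoice[OF this] obtain C where C: "\<And>s. s \<in> S \<Longrightarrow>
      P.prob {z \<in> space ?P. (z \<in> B s) \<noteq> (readout q D z \<in> C s)} \<le> e'"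
    by blast
  let ?N = "\<lambda>s. {z \<in> space ?P. (z \<in> B s) \<noteq> (readout q D z \<in> C s)}"
  have N: "?N s \<in> sets ?P" if "s \<in> S" for s
    using sets_readout_approximation[OF qD(1,2) B[OF that]] .
  define g where "g f = (if \<exists>s\<in>S. f \<in> C s then SOME s. s \<in> S \<and> f \<in> C s else s0)" for f
  have "g f \<in> S" for f
  proof (cases "\<exists>s\<in>S. f \<in> C s")
    case True
    then have "\<exists>s. s \<in> S \<and> f \<in> C s"
      by blast
    from someI_ex[OF this] True show ?thesis
      by (simp add: g_def)
  next
    case False
    with \<open>s0 \<in> S\<close> show ?thesis
      by (simp only: g_def if_False)
  qed
  have "{z \<in> space ?P. F z \<noteq> g (readout q D z)} \<subseteq> (\<Union>s\<in>S. ?N s)"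
  proof (rule subsetI, rule ccontr)
    fix z assume z: "z \<in> {z \<in> space ?P. F z \<noteq> g (readout q D z)}" and "z \<notin> (\<Union>s\<in>S. ?N s)"
    then have "(F z = s) = (readout q D z \<in> C s)" if "s \<in> S" for s
      using that by (auto simp: B_def)
    then have "g (readout q D z) = F z"
      using FS[of z] z unfolding g_def by (auto intro!: some_equality)
    with z show False
      by simp
  qed
  then have "P.prob {z \<in> space ?P. F z \<noteq> g (readout q D z)} \<le> P.prob (\<Union>s\<in>S. ?N s)"
    using N assms(3) by (intro P.finite_measure_mono) auto
  also have "\<dots> \<le> (\<Sum>s\<in>S. P.prob (?N s))"
    using N assms(3) by (intro P.finite_measure_subadditive_finite) auto
  also have "\<dots> \<le> real (card S) * e'"
    using C by (intro sum_bounded_above) auto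
  also have "\<dots> \<le> e"
    using assms(4) by (simp add: e'_def field_simps add_nonneg_pos)
  finally show ?thesis
    using qD(1,2) \<open>\<And>f. g f \<in> S\<close> by blast
qed

section \<open>Independent uniform seeds\<close>

lemma prob_space_unit_interval: "prob_space unit_interval"
  unfolding unit_interval_def by (intro prob_spaceI) (simp add: emeasure_restrict_space space_restrict_space)

lemma measurable_id_unit_interval [measurable]: "(\<lambda>x. x) \<in> borel_measurable unit_interval"
  unfolding unit_interval_def by (intro measurable_restrict_space1) simp

lemma AE_unit_interval_neq: "AE y in unit_interval. x \<noteq> y"
proof (rule AE_I')
  show "{y \<in> space unit_interval. y = x} \<in> null_sets unit_interval"
    unfolding null_sets_def unit_interval_def
    by (auto simp: space_restrict_space sets_restrict_space emeasure_restrict_space Collect_conv_if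
        intro!: image_eqI[of _ _ "{x}"])
qed auto

text \<open>
  With the seeds as arrival times, these are the vertices of \<open>D\<close> whose seeds are revealed before the
  one of \<open>k\<close>.
\<close>

definition below :: "'v set \<Rightarrow> 'v \<Rightarrow> ('v \<Rightarrow> real) \<Rightarrow> 'v set" where
  "below D k z = {w\<in>D. z w < z k}"

lemma simple_function_below:
  assumes "finite D"
  shows "simple_function (\<Pi>\<^sub>M v\<in>UNIV. unit_interval) (below D k)"
  unfolding simple_function_def
proof (intro conjI ballI)
  let ?P = "\<Pi>\<^sub>M v\<in>(UNIV :: 'a set). unit_interval"
  show "finite (below D k ` space ?P)"
    by (rule finite_subset[of _ "Pow D"]) (auto simp: below_def assms)
  fix A assume "A \<in> below D k ` space ?P"
  then have "A \<subseteq> D"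
    by (auto simp: below_def)
  then have "below D k z = A \<longleftrightarrow> (\<forall>w\<in>D. (z w < z k) = (w \<in> A))" for z
    unfolding below_def set_eq_iff mem_Collect_eq by blast
  then have eq: "below D k -` {A} \<inter> space ?P = {z \<in> space ?P. \<forall>w\<in>D. (z w < z k) = (w \<in> A)}"
    by (simp only: vimage_def Int_def singleton_iff mem_Collect_eq conj_commute)
  have coord [measurable]: "(\<lambda>z. z v) \<in> borel_measurable ?P" for v
    using measurable_compose[OF measurable_component_singleton[of v UNIV "\<lambda>_. unit_interval"]
        measurable_id_unit_interval] by simp
  have "{z \<in> space ?P. (z w < z k) = (w \<in> A)} \<in> sets ?P" for w
    by (cases "w \<in> A") simp_all
  then show "below D k -` {A} \<inter> space ?P \<in> sets ?P"
    unfolding eq using assms by (intro sets.sets_Collect_finite_All) auto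
qed

locale uniform_seeds = information_space M b for M :: "'w measure" and b +
  fixes Z :: "'v \<Rightarrow> 'w \<Rightarrow> real"
  assumes indep: "indep_vars (\<lambda>_. unit_interval) Z UNIV"
    and distr: "\<And>v. distr M unit_interval (Z v) = unit_interval"
begin

abbreviation "P \<equiv> \<Pi>\<^sub>M v\<in>(UNIV :: 'v set). unit_interval"

lemma measurable_Z: "Z v \<in> M \<rightarrow>\<^sub>M unit_interval"
  using indep unfolding indep_vars_def2 by simp

lemma measurable_seeds: "(\<lambda>\<omega> v. Z (\<sigma> v) \<omega>) \<in> M \<rightarrow>\<^sub>M P"
  using measurable_restrict[of UNIV "\<lambda>v. Z (\<sigma> v)" M "\<lambda>_. unit_interval"] measurable_Z by (simp add: restrict_UNIV)

lemma distr_seeds: "distr M P (\<lambda>\<omega> v. Z v \<omega>) = P"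
  using indep indep_vars_iff_distr_eq_PiM[of UNIV Z "\<lambda>_. unit_interval"] measurable_Z distr by (simp add: restrict_UNIV)

lemma distr_seeds_permute:
  assumes "bij \<sigma>"
  shows "distr M P (\<lambda>\<omega> v. Z (\<sigma> v) \<omega>) = P"
proof -
  have reindex: "distr P P (\<lambda>z v. z (\<sigma> v)) = P"
    using distr_PiM_reindex[of UNIV "\<lambda>_. unit_interval" \<sigma> UNIV] prob_space_unit_interval assms
    by (simp add: bij_is_inj restrict_UNIV)
  have "(\<lambda>z v. z (\<sigma> v)) \<in> P \<rightarrow>\<^sub>M P"
    using measurable_restrict[of UNIV "\<lambda>v z. z (\<sigma> v)" P "\<lambda>_. unit_interval"] by (simp add: restrict_UNIV)
  then have "distr (distr M P (\<lambda>\<omega> v. Z v \<omega>)) P (\<lambda>z v. z (\<sigma> v)) = distr M P (\<lambda>\<omega> v. Z (\<sigma> v) \<omega>)"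
    using measurable_seeds[of "\<lambda>v. v"] by (subst distr_distr) (simp_all add: comp_def)
  then show ?thesis
    unfolding distr_seeds reindex by simp
qed

lemma prob_seeds_permute:
  assumes "bij \<sigma>" "B \<in> sets P"
  shows "prob {\<omega> \<in> space M. (\<lambda>v. Z (\<sigma> v) \<omega>) \<in> B} = measure P B"
proof -
  have "measure P B = measure (distr M P (\<lambda>\<omega> v. Z (\<sigma> v) \<omega>)) B"
    unfolding distr_seeds_permute[OF assms(1)] ..
  also have "\<dots> = prob {\<omega> \<in> space M. (\<lambda>v. Z (\<sigma> v) \<omega>) \<in> B}"
    using assms(2) by (subst measure_distr[OF measurable_seeds]) (auto simp: vimage_def Int_def conj_commute)
  finally show ?thesis ..
qed

lemma simple_function_seeds:
  assumes "simple_function P \<Phi>"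
  shows "simple_function M (\<lambda>\<omega>. \<Phi> (\<lambda>v. Z (\<sigma> v) \<omega>))"
  unfolding simple_function_def
proof (intro conjI ballI)
  note sp = measurable_space[OF measurable_seeds]
  show "finite ((\<lambda>\<omega>. \<Phi> (\<lambda>v. Z (\<sigma> v) \<omega>)) ` space M)"
    by (rule finite_subset[OF _ simple_functionD(1)[OF assms]]) (use sp in auto)
  fix y
  have "(\<lambda>\<omega> v. Z (\<sigma> v) \<omega>) -` (\<Phi> -` {y} \<inter> space P) \<inter> space M \<in> events"
    using measurable_sets[OF measurable_seeds simple_functionD(2)[OF assms]] .
  also have "(\<lambda>\<omega> v. Z (\<sigma> v) \<omega>) -` (\<Phi> -` {y} \<inter> space P) \<inter> space M =
      (\<lambda>\<omega>. \<Phi> (\<lambda>v. Z (\<sigma> v) \<omega>)) -` {y} \<inter> space M"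
    using sp by auto
  finally show "(\<lambda>\<omega>. \<Phi> (\<lambda>v. Z (\<sigma> v) \<omega>)) -` {y} \<inter> space M \<in> events" .
qed

lemma entropy_seeds_permute:
  assumes "simple_function P \<Phi>" "bij \<sigma>"
  shows "\<H>(\<lambda>\<omega>. \<Phi> (\<lambda>v. Z (\<sigma> v) \<omega>)) = \<H>(\<lambda>\<omega>. \<Phi> (\<lambda>v. Z v \<omega>))"
proof (rule entropy_cong_distr)
  fix y
  let ?B = "\<Phi> -` {y} \<inter> space P"
  have event: "(\<lambda>\<omega>. \<Phi> (\<lambda>v. Z (\<tau> v) \<omega>)) -` {y} \<inter> space M = {\<omega> \<in> space M. (\<lambda>v. Z (\<tau> v) \<omega>) \<in> ?B}" for \<tau>
    using measurable_space[OF measurable_seeds] by auto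
  have "prob ((\<lambda>\<omega>. \<Phi> (\<lambda>v. Z (\<tau> v) \<omega>)) -` {y} \<inter> space M) = measure P ?B" if "bij \<tau>" for \<tau>
    unfolding event using prob_seeds_permute[OF that simple_functionD(2)[OF assms(1)]] .
  from this[OF assms(2)] this[OF bij_id]
  show "prob ((\<lambda>\<omega>. \<Phi> (\<lambda>v. Z (\<sigma> v) \<omega>)) -` {y} \<inter> space M) =
      prob ((\<lambda>\<omega>. \<Phi> (\<lambda>v. Z v \<omega>)) -` {y} \<inter> space M)"
    by simp
qed (use simple_function_seeds[OF assms(1)] simple_function_seeds[OF assms(1), of "\<lambda>v. v"] in auto)

text \<open>
  The joint law of two seeds is the product measure, and each of its sections of the diagonal is a
  single point.
\<close>

lemma AE_seeds_distinct:
  assumes "j \<noteq> k"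
  shows "AE \<omega> in M. Z j \<omega> \<noteq> Z k \<omega>"
proof -
  let ?U = unit_interval
  interpret U: prob_space ?U
    by (rule prob_space_unit_interval)
  have pair: "(\<lambda>\<omega>. (Z j \<omega>, Z k \<omega>)) \<in> M \<rightarrow>\<^sub>M ?U \<Otimes>\<^sub>M ?U"
    using measurable_Z by (intro measurable_Pair)
  have joint: "?U \<Otimes>\<^sub>M ?U = distr M (?U \<Otimes>\<^sub>M ?U) (\<lambda>\<omega>. (Z j \<omega>, Z k \<omega>))"
  proof (rule pair_measure_eqI)
    fix A B assume A: "A \<in> sets ?U" and B: "B \<in> sets ?U"
    have single: "emeasure ?U C = prob (Z v -` C \<inter> space M)" if "C \<in> sets ?U" for v C
      using that emeasure_distr[OF measurable_Z that, of v] by (simp add: distr emeasure_eq_measure)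
    have "prob (\<Inter>v\<in>{j, k}. Z v -` (if v = j then A else B) \<inter> space M) =
        (\<Prod>v\<in>{j, k}. prob (Z v -` (if v = j then A else B) \<inter> space M))"
      using A B by (intro indep_varsD[OF indep]) auto
    moreover have "(\<Inter>v\<in>{j, k}. Z v -` (if v = j then A else B) \<inter> space M) =
        (\<lambda>\<omega>. (Z j \<omega>, Z k \<omega>)) -` (A \<times> B) \<inter> space M"
      using assms by auto
    ultimately have "prob ((\<lambda>\<omega>. (Z j \<omega>, Z k \<omega>)) -` (A \<times> B) \<inter> space M) =
        prob (Z j -` A \<inter> space M) * prob (Z k -` B \<inter> space M)"
      using assms by simp
    then show "emeasure ?U A * emeasure ?U B =
        emeasure (distr M (?U \<Otimes>\<^sub>M ?U) (\<lambda>\<omega>. (Z j \<omega>, Z k \<omega>))) (A \<times> B)"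
      using A B by (subst emeasure_distr[OF pair])
        (simp_all add: single[OF A, of j] single[OF B, of k] emeasure_eq_measure ennreal_mult)
  qed (simp_all add: U.sigma_finite_measure_axioms)
  interpret UU: pair_sigma_finite ?U ?U ..
  have "AE p in ?U \<Otimes>\<^sub>M ?U. fst p \<noteq> snd p"
  proof (rule UU.AE_pair_measure)
    have "{p \<in> space (?U \<Otimes>\<^sub>M ?U). fst p = snd p} \<in> sets (?U \<Otimes>\<^sub>M ?U)"
      by measurable
    then show "{p \<in> space (?U \<Otimes>\<^sub>M ?U). fst p \<noteq> snd p} \<in> sets (?U \<Otimes>\<^sub>M ?U)"
      by (rule sets.sets_Collect_neg)
    show "AE x in ?U. AE y in ?U. fst (x, y) \<noteq> snd (x, y)"
      by (rule AE_I2) (simp add: AE_unit_interval_neq)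
  qed
  then have "AE p in distr M (?U \<Otimes>\<^sub>M ?U) (\<lambda>\<omega>. (Z j \<omega>, Z k \<omega>)). fst p \<noteq> snd p"
    by (subst joint[symmetric])
  from AE_distrD[OF pair this] show ?thesis
    by simp
qed

lemma AE_seeds_inj_on:
  assumes "finite D"
  shows "AE \<omega> in M. inj_on (\<lambda>v. Z v \<omega>) D"
proof -
  have "AE \<omega> in M. j \<noteq> k \<longrightarrow> Z j \<omega> \<noteq> Z k \<omega>" for j k
    using AE_seeds_distinct[of j k] by (cases "j = k") auto
  then have "AE \<omega> in M. \<forall>j\<in>D. \<forall>k\<in>D. j \<noteq> k \<longrightarrow> Z j \<omega> \<noteq> Z k \<omega>"
    using assms by (simp add: AE_finite_all)
  then show ?thesis
    by eventually_elim (auto simp: inj_on_def)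
qed

text \<open>
  The difference is the conditional entropy of \<open>\<Psi>\<close> given the readout. It is bounded by the conditional
  entropy given an approximation \<open>G n\<close> of \<open>\<Psi>\<close>, which tends to that of \<open>\<Psi>\<close> given itself, that
  is, to zero. This is the step at which the seeds have to carry all the randomness of the process.
\<close>

lemma entropy_given_readout_small:
  fixes \<Psi> :: "('v \<Rightarrow> real) \<Rightarrow> 's"
  assumes \<Psi>: "\<Psi> \<in> P \<rightarrow>\<^sub>M count_space S" and "finite S" and "0 < e"
  shows "\<exists>q D0. finite_coding unit_interval q \<and> finite D0 \<and> (\<forall>D. finite D \<and> D0 \<subseteq> D \<longrightarrow>
    \<H>(\<lambda>\<omega>. (\<Psi> (\<lambda>v. Z v \<omega>), readout q D (\<lambda>v. Z v \<omega>))) - \<H>(\<lambda>\<omega>. readout q D (\<lambda>v. Z v \<omega>)) \<le> e)"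
proof -
  \<comment> \<open>Errors that tend to zero are needed to pass to the limit in the entropies.\<close>
  define close where "close n q D g \<longleftrightarrow> finite_coding unit_interval q \<and> finite D \<and> range g \<subseteq> S \<and>
      measure P {z \<in> space P. \<Psi> z \<noteq> g (readout q D z)} \<le> inverse (real (Suc n))" for n q D g
  have "\<exists>q D g. close n q D g" for n
    unfolding close_def
    by (intro measurable_approximable prob_space_unit_interval \<Psi> \<open>finite S\<close>) simp
  then obtain q D g where close: "\<And>n. close n (q n) (D n) (g n)"
    by metis
  then have q: "finite_coding unit_interval (q n)" and D: "finite (D n)" and g: "range (g n) \<subseteq> S" for n
    by (auto simp: close_def)
  have sf\<Psi>: "simple_function P \<Psi>"
    using \<Psi> \<open>finite S\<close> by (rule simple_function_count_space_finite)
  define Y where "Y \<omega> = \<Psi> (\<lambda>v. Z v \<omega>)" for \<omega>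
  define G where "G n \<omega> = g n (readout (q n) (D n) (\<lambda>v. Z v \<omega>))" for n \<omega>
  have Y: "simple_function M Y"
    unfolding Y_def using simple_function_seeds[OF sf\<Psi>] .
  have sfg: "simple_function P (\<lambda>z. g n (readout (q n) (D n) z))" for n
    using simple_function_compose1[OF simple_function_readout[OF q D]] .
  have G: "simple_function M (G n)" for n
    unfolding G_def using simple_function_seeds[OF sfg] .
  have G_in: "G n \<omega> \<in> S" for n \<omega>
    using g by (auto simp: G_def)
  have YS: "Y ` space M \<subseteq> S"
    using measurable_space[OF \<Psi> measurable_space[OF measurable_seeds]] by (auto simp: Y_def)
  have GS: "G n ` space M \<subseteq> S" for n
    using G_in by auto
  have error: "prob {\<omega> \<in> space M. G n \<omega> \<noteq> Y \<omega>} \<le> inverse (real (Suc n))" for n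
  proof -
    let ?B = "{z \<in> space P. \<Psi> z \<noteq> g n (readout (q n) (D n) z)}"
    have "?B = (\<lambda>z. (\<Psi> z, g n (readout (q n) (D n) z))) -` {p. fst p \<noteq> snd p} \<inter> space P"
      by auto
    also have "\<dots> \<in> sets P"
      by (rule simple_functionD(2)[OF simple_function_Pair[OF sf\<Psi> sfg]])
    finally have "prob {\<omega> \<in> space M. (\<lambda>v. Z v \<omega>) \<in> ?B} = measure P ?B"
      using prob_seeds_permute[OF bij_id, of ?B] by simp
    also have "{\<omega> \<in> space M. (\<lambda>v. Z v \<omega>) \<in> ?B} = {\<omega> \<in> space M. G n \<omega> \<noteq> Y \<omega>}"
      using measurable_space[OF measurable_seeds[of "\<lambda>v. v"]] by (auto simp: G_def Y_def)
    finally show ?thesis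
      using close[of n] by (simp add: close_def)
  qed
  have lim0: "(\<lambda>n. prob {\<omega> \<in> space M. G n \<omega> \<noteq> Y \<omega>}) \<longlonglongrightarrow> 0"
    using error by (intro Lim_null_comparison[OF _ LIMSEQ_inverse_real_of_nat] always_eventually) auto
  have "(\<lambda>n. \<H>(\<lambda>\<omega>. (Y \<omega>, G n \<omega>)) - \<H>(G n)) \<longlonglongrightarrow> \<H>(\<lambda>\<omega>. (Y \<omega>, Y \<omega>)) - \<H>(Y)"
  proof (intro tendsto_diff)
    show "(\<lambda>n. \<H>(G n)) \<longlonglongrightarrow> \<H>(Y)"
      using G Y \<open>finite S\<close> GS YS lim0 by (rule tendsto_entropy)
    show "(\<lambda>n. \<H>(\<lambda>\<omega>. (Y \<omega>, G n \<omega>))) \<longlonglongrightarrow> \<H>(\<lambda>\<omega>. (Y \<omega>, Y \<omega>))"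
    proof (rule tendsto_entropy[where B = "S \<times> S"])
      show "(\<lambda>n. prob {\<omega> \<in> space M. (Y \<omega>, G n \<omega>) \<noteq> (Y \<omega>, Y \<omega>)}) \<longlonglongrightarrow> 0"
        using lim0 by simp
    qed (use simple_function_Pair[OF Y G] simple_function_Pair[OF Y Y] \<open>finite S\<close> YS G_in in auto)
  qed
  also have "\<H>(\<lambda>\<omega>. (Y \<omega>, Y \<omega>)) = \<H>(Y)"
    by (rule entropy_recode[OF Y, where f = "\<lambda>y. (y, y)"]) (auto simp: inj_on_def)
  finally have "\<forall>\<^sub>F n in sequentially. \<H>(\<lambda>\<omega>. (Y \<omega>, G n \<omega>)) - \<H>(G n) < e"
    using \<open>0 < e\<close> by (intro order_tendstoD(2)) auto
  then obtain n where n: "\<H>(\<lambda>\<omega>. (Y \<omega>, G n \<omega>)) - \<H>(G n) < e"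
    by (auto dest: eventually_happens)
  have "\<H>(\<lambda>\<omega>. (Y \<omega>, readout (q n) D' (\<lambda>v. Z v \<omega>))) - \<H>(\<lambda>\<omega>. readout (q n) D' (\<lambda>v. Z v \<omega>)) \<le> e"
    if D': "finite D'" "D n \<subseteq> D'" for D'
  proof -
    have "\<H>(\<lambda>\<omega>. (Y \<omega>, readout (q n) D' (\<lambda>v. Z v \<omega>))) - \<H>(\<lambda>\<omega>. readout (q n) D' (\<lambda>v. Z v \<omega>)) \<le>
        \<H>(\<lambda>\<omega>. (Y \<omega>, G n \<omega>)) - \<H>(G n)"
    proof (rule entropy_increment_antimono[OF Y simple_function_seeds[OF simple_function_readout[OF q D'(1)]]])
      fix \<omega> assume "\<omega> \<in> space M"
      show "G n \<omega> = (\<lambda>f. g n (\<lambda>k. if k \<in> D n then f k else 0)) (readout (q n) D' (\<lambda>v. Z v \<omega>))"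
        using readout_refine[OF D'(2), of "\<lambda>x. x" "q n"] by (simp add: G_def comp_def)
    qed
    with n show ?thesis
      by simp
  qed
  with q[of n] D[of n] show ?thesis
    unfolding Y_def by blast
qed

end

section \<open>Shapley shares of the seeds\<close>

text \<open>
  Adding the elements of \<open>D\<close> one by one in increasing order of \<open>t\<close>, the increments telescope;
  ties would spoil this.
\<close>

lemma sum_increments_along_order:
  fixes g :: "'a set \<Rightarrow> real" and t :: "'a \<Rightarrow> 'b :: linorder"
  assumes "finite D" "inj_on t D"
  shows "(\<Sum>k\<in>D. g (insert k {w\<in>D. t w < t k}) - g {w\<in>D. t w < t k}) = g D - g {}"
  using assms
proof (induction D rule: finite_ranking_induct[where f = t])
  case (insert x D)
  show ?case
  proof (cases "x \<in> D")
    case True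
    with insert show ?thesis
      by (simp add: insert_absorb)
  next
    case False
    have below: "t y < t x" if "y \<in> D" for y
      using insert(2)[OF that] insert.prems that False by (metis inj_onD insertCI order_le_imp_less_or_eq)
    have "{w \<in> insert x D. t w < t k} = {w\<in>D. t w < t k}" if "k \<in> D" for k
      using below[OF that] by auto
    moreover have "{w \<in> insert x D. t w < t x} = D"
      using below by auto
    ultimately show ?thesis
      using insert False by simp
  qed
qed simp

locale coded_seeds = uniform_seeds M b Z for M :: "'w measure" and b and Z :: "'v \<Rightarrow> 'w \<Rightarrow> real" +
  fixes q :: "real \<Rightarrow> nat"
  assumes coding: "finite_coding unit_interval q"
begin

definition coarse_seed :: "'v \<Rightarrow> 'w \<Rightarrow> nat" where
  "coarse_seed k \<omega> = q (Z k \<omega>)"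

definition obs :: "'v set \<Rightarrow> 'w \<Rightarrow> 'v \<Rightarrow> nat" where
  "obs A \<omega> = readout q A (\<lambda>v. Z v \<omega>)"

lemma obs_apply: "obs A \<omega> k = (if k \<in> A then coarse_seed k \<omega> else 0)"
  by (simp add: obs_def readout_def coarse_seed_def)

lemma obs_insert: "obs (insert k A) \<omega> = (obs A \<omega>)(k := coarse_seed k \<omega>)"
  by (auto simp: obs_apply fun_eq_iff)

lemma simple_function_obs: "finite A \<Longrightarrow> simple_function M (obs A)"
  unfolding obs_def by (rule simple_function_seeds[OF simple_function_readout[OF coding]])

lemma simple_function_coarse_seed: "simple_function M (coarse_seed k)"
proof -
  have "coarse_seed k = (\<lambda>\<omega>. obs {k} \<omega> k)"
    by (auto simp: obs_apply fun_eq_iff)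
  then show ?thesis
    using simple_function_compose1[OF simple_function_obs[of "{k}"], of "\<lambda>f. f k"] by simp
qed

lemma indep_coarse_seeds: "indep_vars (\<lambda>_. count_space UNIV) coarse_seed UNIV"
proof -
  have "indep_vars (\<lambda>_. count_space UNIV) (\<lambda>k \<omega>. q (Z k \<omega>)) UNIV"
    by (rule indep_vars_compose2[OF indep]) (use coding in \<open>simp add: finite_coding_def\<close>)
  then show ?thesis
    by (simp add: coarse_seed_def[abs_def])
qed

lemma prob_obs:
  assumes "finite A" "\<And>k. k \<notin> A \<Longrightarrow> f k = 0"
  shows "prob (obs A -` {f} \<inter> space M) = (\<Prod>k\<in>A. prob (coarse_seed k -` {f k} \<inter> space M))"
proof (cases "A = {}")
  case True
  then have "obs A -` {f} \<inter> space M = space M"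
    using assms(2) by (auto simp: obs_apply fun_eq_iff)
  with True show ?thesis
    by (simp add: prob_space)
next
  case False
  have "prob (\<Inter>k\<in>A. coarse_seed k -` {f k} \<inter> space M) = (\<Prod>k\<in>A. prob (coarse_seed k -` {f k} \<inter> space M))"
    using False assms(1) by (intro indep_varsD[OF indep_coarse_seeds]) auto
  also have "(\<Inter>k\<in>A. coarse_seed k -` {f k} \<inter> space M) = obs A -` {f} \<inter> space M"
    using False assms(2) by (auto simp: obs_apply fun_eq_iff)
  finally show ?thesis .
qed

text \<open>
  Recode the extended observation as a pair; its two parts are independent because the seeds are.
\<close>

lemma entropy_obs_insert_indep:
  assumes "finite A" "k \<notin> A"
  shows "\<H>(obs (insert k A)) = \<H>(coarse_seed k) + \<H>(obs A)"
proof -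
  note sf = simple_function_coarse_seed[of k] simple_function_obs[OF assms(1)]
  have "\<H>(obs (insert k A)) = \<H>(\<lambda>\<omega>. (coarse_seed k \<omega>, obs A \<omega>))"
  proof (rule entropy_recode[OF simple_function_Pair[OF sf], where f = "\<lambda>(d, r). r(k := d)"])
    show "inj_on (\<lambda>(d, r). r(k := d)) ((\<lambda>\<omega>. (coarse_seed k \<omega>, obs A \<omega>)) ` space M)"
    proof (rule inj_onI, clarsimp)
      fix \<omega> \<omega>' assume eq: "(obs A \<omega>)(k := coarse_seed k \<omega>) = (obs A \<omega>')(k := coarse_seed k \<omega>')"
      have "obs A \<omega> j = obs A \<omega>' j" for j
        using fun_cong[OF eq, of j] assms(2) by (cases "j = k") (simp_all add: obs_apply)
      with fun_cong[OF eq, of k] show "coarse_seed k \<omega> = coarse_seed k \<omega>' \<and> obs A \<omega> = obs A \<omega>'"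
        by auto
    qed
  qed (simp add: obs_insert)
  also have "\<dots> = \<H>(coarse_seed k) + \<H>(obs A)"
  proof (rule entropy_Pair_indep[OF sf])
    fix d f
    show "prob ((\<lambda>\<omega>. (coarse_seed k \<omega>, obs A \<omega>)) -` {(d, f)} \<inter> space M) =
        prob (coarse_seed k -` {d} \<inter> space M) * prob (obs A -` {f} \<inter> space M)"
    proof (cases "\<forall>j. j \<notin> A \<longrightarrow> f j = 0")
      case True
      with assms(2) have "(\<lambda>\<omega>. (coarse_seed k \<omega>, obs A \<omega>)) -` {(d, f)} \<inter> space M =
          obs (insert k A) -` {f(k := d)} \<inter> space M"
        by (auto simp: obs_apply fun_eq_iff split: if_splits)
      moreover have "prob (obs (insert k A) -` {f(k := d)} \<inter> space M) =
          (\<Prod>j\<in>insert k A. prob (coarse_seed j -` {(f(k := d)) j} \<inter> space M))"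
        using True assms(1) by (intro prob_obs) auto
      moreover have "(\<Prod>j\<in>A. prob (coarse_seed j -` {(f(k := d)) j} \<inter> space M)) =
          (\<Prod>j\<in>A. prob (coarse_seed j -` {f j} \<inter> space M))"
        using assms(2) by (intro prod.cong) auto
      moreover have "prob (obs A -` {f} \<inter> space M) = (\<Prod>j\<in>A. prob (coarse_seed j -` {f j} \<inter> space M))"
        using True assms(1) by (intro prob_obs) auto
      ultimately show ?thesis
        using assms by simp
    next
      case False
      then have "(\<lambda>\<omega>. (coarse_seed k \<omega>, obs A \<omega>)) -` {(d, f)} \<inter> space M = {}" "obs A -` {f} \<inter> space M = {}"
        by (auto simp: obs_apply fun_eq_iff)
      then show ?thesis
        by (simp only: measure_empty mult_zero_right)
    qed
  qed
  finally show ?thesis .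
qed

lemma entropy_obs: "finite D \<Longrightarrow> \<H>(obs D) = (\<Sum>k\<in>D. \<H>(coarse_seed k))"
proof (induction D rule: finite_induct)
  case empty
  have "obs {} = (\<lambda>\<omega>. \<lambda>_. 0)"
    by (simp add: obs_apply fun_eq_iff)
  then show ?case
    by (simp add: entropy_const)
qed (simp add: entropy_obs_insert_indep)

text \<open>
  For \<open>k \<notin> A\<close> the coarse seed at \<open>k\<close> is independent of \<open>obs A\<close>, so this is the conditional mutual
  information of \<open>Y\<close> and that coarse seed given \<open>obs A\<close>. In this form it is also the entropy of
  the coarse seed minus its conditional entropy given \<open>Y\<close> and \<open>obs A\<close>, which makes its monotonicity
  visible.
\<close>

definition gain :: "('w \<Rightarrow> 's) \<Rightarrow> 'v \<Rightarrow> 'v set \<Rightarrow> real" where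
  "gain Y k A = \<H>(coarse_seed k) + \<H>(\<lambda>\<omega>. (Y \<omega>, obs A \<omega>)) - \<H>(\<lambda>\<omega>. (Y \<omega>, obs (insert k A) \<omega>))"

lemma entropy_Pair_obs_insert:
  assumes "simple_function M Y" "finite A" "k \<notin> A"
  shows "\<H>(\<lambda>\<omega>. (Y \<omega>, obs (insert k A) \<omega>)) = \<H>(\<lambda>\<omega>. (coarse_seed k \<omega>, Y \<omega>, obs A \<omega>))"
proof (rule entropy_recode[where f = "\<lambda>(d, y, r). (y, r(k := d))"])
  show "simple_function M (\<lambda>\<omega>. (coarse_seed k \<omega>, Y \<omega>, obs A \<omega>))"
    using assms by (intro simple_function_Pair simple_function_coarse_seed simple_function_obs)
  show "inj_on (\<lambda>(d, y, r). (y, r(k := d))) ((\<lambda>\<omega>. (coarse_seed k \<omega>, Y \<omega>, obs A \<omega>)) ` space M)"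
  proof (rule inj_onI, clarsimp)
    fix \<omega> \<omega>' assume eq: "(obs A \<omega>)(k := coarse_seed k \<omega>) = (obs A \<omega>')(k := coarse_seed k \<omega>')"
    have "obs A \<omega> j = obs A \<omega>' j" for j
      using fun_cong[OF eq, of j] assms(3) by (cases "j = k") (simp_all add: obs_apply)
    with fun_cong[OF eq, of k] show "coarse_seed k \<omega> = coarse_seed k \<omega>' \<and> obs A \<omega> = obs A \<omega>'"
      by auto
  qed
qed (simp add: obs_insert)

lemma gain_nonneg:
  assumes "simple_function M Y" "finite A" "k \<notin> A"
  shows "0 \<le> gain Y k A"
  unfolding gain_def entropy_Pair_obs_insert[OF assms]
  using entropy_Pair_le[OF simple_function_coarse_seed simple_function_Pair[OF assms(1) simple_function_obs[OF assms(2)]], of k]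
  by simp

text \<open>
  The entropy of the coarse seed at \<open>k\<close> does not depend on \<open>Y\<close> or \<open>A\<close>, and conditioning on
  \<open>Y'\<close> and \<open>obs A'\<close> is finer than conditioning on \<open>Y\<close> and \<open>obs A\<close>.
\<close>

lemma gain_mono:
  assumes Y': "simple_function M Y'" and Y: "simple_function M Y"
    and g: "\<And>\<omega>. \<omega> \<in> space M \<Longrightarrow> Y \<omega> = g (Y' \<omega>)"
    and "finite A'" "A \<subseteq> A'" "k \<notin> A'"
  shows "gain Y k A \<le> gain Y' k A'"
proof -
  have A: "finite A" "k \<notin> A"
    using assms finite_subset by auto
  have "\<H>(\<lambda>\<omega>. (coarse_seed k \<omega>, Y' \<omega>, obs A' \<omega>)) - \<H>(\<lambda>\<omega>. (Y' \<omega>, obs A' \<omega>)) \<le>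
      \<H>(\<lambda>\<omega>. (coarse_seed k \<omega>, Y \<omega>, obs A \<omega>)) - \<H>(\<lambda>\<omega>. (Y \<omega>, obs A \<omega>))"
    using simple_function_coarse_seed simple_function_Pair[OF Y' simple_function_obs[OF \<open>finite A'\<close>]]
  proof (rule entropy_increment_antimono)
    fix \<omega> assume "\<omega> \<in> space M"
    then show "(Y \<omega>, obs A \<omega>) = (\<lambda>(y, r). (g y, \<lambda>j. if j \<in> A then r j else 0)) (Y' \<omega>, obs A' \<omega>)"
      using g \<open>A \<subseteq> A'\<close> by (auto simp: obs_apply fun_eq_iff)
  qed
  then show ?thesis
    unfolding gain_def entropy_Pair_obs_insert[OF Y A] entropy_Pair_obs_insert[OF Y' \<open>finite A'\<close> \<open>k \<notin> A'\<close>]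
    by simp
qed

text \<open>
  The Shapley value of the player \<open>k\<close> in the game \<open>A \<mapsto> I(Y; obs A)\<close> on the players \<open>D\<close>. The random
  order of arrival is the order of the seeds themselves. Since \<open>gain\<close> is deterministic in its set
  argument, this order may depend on the same seeds that determine \<open>Y\<close>.
\<close>

definition shapley :: "('w \<Rightarrow> 's) \<Rightarrow> 'v set \<Rightarrow> 'v \<Rightarrow> real" where
  "shapley Y D k = (if k \<in> D then \<integral>\<omega>. gain Y k (below D k (\<lambda>v. Z v \<omega>)) \<partial>M else 0)"

lemma below_subset: "below D k z \<subseteq> D - {k}"
  by (auto simp: below_def)

lemma finite_below: "finite D \<Longrightarrow> finite (below D k z)"
  by (simp add: below_def)

lemma integrable_gain:
  assumes "finite D"
  shows "integrable M (\<lambda>\<omega>. gain Y k (below D k (\<lambda>v. Z v \<omega>)))"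
  using integrable_simple_function_compose[OF simple_function_seeds[OF simple_function_below[OF assms]]] .

lemma shapley_nonneg:
  assumes "simple_function M Y" "finite D"
  shows "0 \<le> shapley Y D k"
  unfolding shapley_def
  using assms below_subset[of D k] by (auto intro!: integral_nonneg_AE gain_nonneg finite_below)

text \<open>
  All windows use the same order, so enlarging the window enlarges the set of
  earlier seeds outcome by outcome, and \<open>gain_mono\<close> applies inside the expectation.
\<close>

lemma shapley_mono:
  assumes Y': "simple_function M Y'" and Y: "simple_function M Y"
    and g: "\<And>\<omega>. \<omega> \<in> space M \<Longrightarrow> Y \<omega> = g (Y' \<omega>)"
    and "finite D'" "D \<subseteq> D'"
  shows "shapley Y D k \<le> shapley Y' D' k"
proof (cases "k \<in> D")
  case True
  have "finite D"
    using assms finite_subset by auto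
  have "(\<integral>\<omega>. gain Y k (below D k (\<lambda>v. Z v \<omega>)) \<partial>M) \<le> (\<integral>\<omega>. gain Y' k (below D' k (\<lambda>v. Z v \<omega>)) \<partial>M)"
  proof (intro integral_mono integrable_gain \<open>finite D\<close> \<open>finite D'\<close>)
    fix \<omega>
    show "gain Y k (below D k (\<lambda>v. Z v \<omega>)) \<le> gain Y' k (below D' k (\<lambda>v. Z v \<omega>))"
      using \<open>D \<subseteq> D'\<close> below_subset[of D' k]
      by (intro gain_mono[OF Y' Y g] finite_below \<open>finite D'\<close>) (auto simp: below_def)
  qed
  with True \<open>D \<subseteq> D'\<close> show ?thesis
    by (auto simp: shapley_def)
next
  case False
  then show ?thesis
    using shapley_nonneg[OF Y' \<open>finite D'\<close>] by (simp add: shapley_def)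
qed

text \<open>
  The efficiency of the Shapley value: the right-hand side is the mutual information of \<open>Y\<close> and
  \<open>obs D\<close>. For almost every outcome the seeds are distinct, so the gains telescope.
\<close>

lemma sum_shapley:
  assumes Y: "simple_function M Y" and D: "finite D"
  shows "(\<Sum>k\<in>D. shapley Y D k) = \<H>(obs D) + \<H>(Y) - \<H>(\<lambda>\<omega>. (Y \<omega>, obs D \<omega>))"
proof -
  have "\<H>(\<lambda>\<omega>. (Y \<omega>, obs {} \<omega>)) = \<H>(Y)"
    by (rule entropy_recode[OF Y, where f = "\<lambda>y. (y, \<lambda>_. 0)"]) (auto simp: obs_apply inj_on_def)
  note empty = this
  have "(\<Sum>k\<in>D. shapley Y D k) = (\<integral>\<omega>. (\<Sum>k\<in>D. gain Y k (below D k (\<lambda>v. Z v \<omega>))) \<partial>M)"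
    using integrable_gain[OF D] by (subst Bochner_Integration.integral_sum) (auto simp: shapley_def)
  also have "\<dots> = (\<integral>\<omega>. \<H>(obs D) + \<H>(Y) - \<H>(\<lambda>\<omega>. (Y \<omega>, obs D \<omega>)) \<partial>M)"
  proof (rule integral_cong_AE)
    show "AE \<omega> in M. (\<Sum>k\<in>D. gain Y k (below D k (\<lambda>v. Z v \<omega>))) =
        \<H>(obs D) + \<H>(Y) - \<H>(\<lambda>\<omega>. (Y \<omega>, obs D \<omega>))"
      using AE_seeds_inj_on[OF D]
    proof eventually_elim
      fix \<omega> assume "inj_on (\<lambda>v. Z v \<omega>) D"
      from sum_increments_along_order[OF D this, of "\<lambda>A. \<H>(\<lambda>\<omega>. (Y \<omega>, obs A \<omega>))"]
      show "(\<Sum>k\<in>D. gain Y k (below D k (\<lambda>v. Z v \<omega>))) =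
          \<H>(obs D) + \<H>(Y) - \<H>(\<lambda>\<omega>. (Y \<omega>, obs D \<omega>))"
        unfolding empty by (simp add: gain_def below_def sum.distrib sum_subtractf entropy_obs[OF D])
    qed
  qed (use integrable_gain[OF D] in \<open>auto intro!: borel_measurable_sum\<close>)
  also have "\<dots> = \<H>(obs D) + \<H>(Y) - \<H>(\<lambda>\<omega>. (Y \<omega>, obs D \<omega>))"
    by (simp add: prob_space)
  finally show ?thesis .
qed

lemma sum_shapley_le_entropy:
  assumes Y: "simple_function M Y" and D: "finite D"
  shows "(\<Sum>k\<in>D. shapley Y D k) \<le> \<H>(Y)"
  unfolding sum_shapley[OF assms] using entropy_le_entropy_Pair[OF Y simple_function_obs[OF D]] by simp

text \<open>
  Both shares of a seed are bounded by its share in the pair, over the union of the two windows.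
\<close>

lemma sum_max_shapley_le_entropy_Pair:
  assumes "simple_function M Y1" "simple_function M Y2" "finite D1" "finite D2"
  shows "(\<Sum>k\<in>D1 \<union> D2. max (shapley Y1 D1 k) (shapley Y2 D2 k)) \<le> \<H>(\<lambda>\<omega>. (Y1 \<omega>, Y2 \<omega>))"
proof -
  note Y = simple_function_Pair[OF assms(1,2)]
  have "(\<Sum>k\<in>D1 \<union> D2. max (shapley Y1 D1 k) (shapley Y2 D2 k)) \<le>
      (\<Sum>k\<in>D1 \<union> D2. shapley (\<lambda>\<omega>. (Y1 \<omega>, Y2 \<omega>)) (D1 \<union> D2) k)"
    using assms
    by (intro sum_mono max.boundedI shapley_mono[OF Y, where g = fst] shapley_mono[OF Y, where g = snd]) auto
  also have "\<dots> \<le> \<H>(\<lambda>\<omega>. (Y1 \<omega>, Y2 \<omega>))"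
    using sum_shapley_le_entropy[OF Y] assms by simp
  finally show ?thesis .
qed

lemma shapley_cong:
  assumes "simple_function M Y" "simple_function M Y'" "finite D"
    and "\<And>\<omega>. \<omega> \<in> space M \<Longrightarrow> Y \<omega> = Y' \<omega>"
  shows "shapley Y D k = shapley Y' D k"
  using assms
  by (intro antisym shapley_mono[where g = "\<lambda>y. y", OF assms(1,2)]
      shapley_mono[where g = "\<lambda>y. y", OF assms(2,1)]) simp_all

text \<open>
  Moving the window, the vertex and the target along a bijection amounts to permuting the seeds, which
  preserves their joint law. That law enters twice: in the entropies inside \<open>gain\<close> and in the order
  over which the expectation is taken.
\<close>

lemma shapley_permute:
  assumes \<Psi>: "simple_function P \<Psi>" and "bij \<sigma>" and D: "finite D"
  shows "shapley (\<lambda>\<omega>. \<Psi> (\<lambda>v. Z (\<sigma> v) \<omega>)) (\<sigma> ` D) (\<sigma> k) = shapley (\<lambda>\<omega>. \<Psi> (\<lambda>v. Z v \<omega>)) D k"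
proof -
  let ?Y = "\<lambda>\<omega>. \<Psi> (\<lambda>v. Z v \<omega>)" and ?Y' = "\<lambda>\<omega>. \<Psi> (\<lambda>v. Z (\<sigma> v) \<omega>)"
  have inj: "inj \<sigma>" and surj: "surj \<sigma>"
    using assms(2) by (auto simp: bij_def)
  have pair: "\<H>(\<lambda>\<omega>. (?Y' \<omega>, obs (\<sigma> ` A) \<omega>)) = \<H>(\<lambda>\<omega>. (?Y \<omega>, obs A \<omega>))" if A: "finite A" for A
  proof -
    let ?\<Phi> = "\<lambda>z. (\<Psi> z, readout q A z)"
    have \<Phi>: "simple_function P ?\<Phi>"
      by (intro simple_function_Pair \<Psi> simple_function_readout[OF coding A])
    have "\<H>(\<lambda>\<omega>. (?Y' \<omega>, obs (\<sigma> ` A) \<omega>)) = \<H>(\<lambda>\<omega>. ?\<Phi> (\<lambda>v. Z (\<sigma> v) \<omega>))"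
    \<comment> \<open>Reading the window \<open>\<sigma> ` A\<close> is reading the permuted seeds in the window \<open>A\<close>, with relabelled coordinates.\<close>
    proof (rule entropy_recode[OF simple_function_seeds[OF \<Phi>], where f = "\<lambda>(y, r). (y, r \<circ> inv \<sigma>)"])
      fix \<omega>
      have "obs (\<sigma> ` A) \<omega> = readout q A (\<lambda>v. Z (\<sigma> v) \<omega>) \<circ> inv \<sigma>"
      proof
        fix k
        obtain j where "k = \<sigma> j"
          using surj by (metis surjD)
        then show "obs (\<sigma> ` A) \<omega> k = (readout q A (\<lambda>v. Z (\<sigma> v) \<omega>) \<circ> inv \<sigma>) k"
          using inj by (simp add: obs_apply coarse_seed_def readout_def inj_image_mem_iff)
      qed
      then show "(?Y' \<omega>, obs (\<sigma> ` A) \<omega>) = (\<lambda>(y, r). (y, r \<circ> inv \<sigma>)) (?\<Phi> (\<lambda>v. Z (\<sigma> v) \<omega>))"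
        by simp
    next
      have "r = r'" if "r \<circ> inv \<sigma> = r' \<circ> inv \<sigma>" for r r' :: "'v \<Rightarrow> nat"
        using fun_cong[OF that, of "\<sigma> _"] inj by (auto simp: fun_eq_iff)
      then show "inj_on (\<lambda>(y, r). (y, r \<circ> inv \<sigma>)) ((\<lambda>\<omega>. ?\<Phi> (\<lambda>v. Z (\<sigma> v) \<omega>)) ` space M)"
        by (auto simp: inj_on_def)
    qed
    also have "\<dots> = \<H>(\<lambda>\<omega>. ?\<Phi> (\<lambda>v. Z v \<omega>))"
      by (rule entropy_seeds_permute[OF \<Phi> assms(2)])
    finally show ?thesis
      by (simp add: obs_def)
  qed
  have coarse_seed: "\<H>(coarse_seed (\<sigma> k)) = \<H>(coarse_seed k)"
  proof -
    have "simple_function P (\<lambda>z. readout q {k} z k)"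
      by (intro simple_function_compose1[OF simple_function_readout[OF coding], where g = "\<lambda>r. r k"]) simp
    from entropy_seeds_permute[OF this assms(2)] show ?thesis
      by (simp add: readout_def coarse_seed_def[abs_def])
  qed
  have gain: "gain ?Y' (\<sigma> k) (\<sigma> ` A) = gain ?Y k A" if "finite A" for A
    using pair[OF that] pair[of "insert k A"] that coarse_seed by (simp add: gain_def)
  have below: "below (\<sigma> ` D) (\<sigma> k) z = \<sigma> ` below D k (\<lambda>v. z (\<sigma> v))" for z
    by (auto simp: below_def)
  have meas: "(\<lambda>z. gain ?Y k (below D k z)) \<in> borel_measurable P"
    by (intro borel_measurable_simple_function simple_function_compose1[OF simple_function_below[OF D]])
  have "(\<integral>\<omega>. gain ?Y' (\<sigma> k) (below (\<sigma> ` D) (\<sigma> k) (\<lambda>v. Z v \<omega>)) \<partial>M) =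
      (\<integral>\<omega>. gain ?Y k (below D k (\<lambda>v. Z (\<sigma> v) \<omega>)) \<partial>M)"
    unfolding below gain[OF finite_below[OF D]] ..
  also have "\<dots> = (\<integral>z. gain ?Y k (below D k z) \<partial>P)"
    using integral_distr[OF measurable_seeds meas, of \<sigma>] distr_seeds_permute[OF assms(2)] by simp
  also have "\<dots> = (\<integral>\<omega>. gain ?Y k (below D k (\<lambda>v. Z v \<omega>)) \<partial>M)"
    using integral_distr[OF measurable_seeds meas, of "\<lambda>v. v"] distr_seeds by simp
  finally show ?thesis
    using inj by (simp add: shapley_def inj_image_mem_iff)
qed

end

section \<open>The entropy inequality for factors of IID\<close>

text \<open>
  Apply the mass-transport principle to the shares \<open>f k v\<close> and to the sums \<open>m k v\<close> of their maxima
  over the edges at \<open>v\<close>; in between, the seed at \<open>u\<close> is fixed and the co-area inequality compares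
  the two as functions of \<open>v\<close>.
\<close>

lemma (in uniform_seeds) entropy_edges_of_factor_ge:
  fixes E :: "'v \<Rightarrow> 'v \<Rightarrow> bool" and F :: "('v \<Rightarrow> real) \<Rightarrow> 'v \<Rightarrow> 's"
  assumes E: "simple_graph E" "connected_graph E" "regular_graph E d" "unimodular_graph E"
    and "finite S" and F: "F \<in> P \<rightarrow>\<^sub>M (\<Pi>\<^sub>M v\<in>UNIV. count_space S)"
    and equiv: "equivariant_on E (UNIV \<rightarrow> {0..1}) F"
  defines "X \<equiv> \<lambda>v \<omega>. F (\<lambda>w. Z w \<omega>) v"
  shows "(d + isoperimetric_const E) * \<H>(X u) \<le> (\<Sum>v\<in>neighbors E u. \<H>(\<lambda>\<omega>. (X u \<omega>, X v \<omega>)))"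
proof -
  let ?c = "d + isoperimetric_const E" and ?R = "\<Sum>v\<in>neighbors E u. \<H>(\<lambda>\<omega>. (X u \<omega>, X v \<omega>))"
  have c: "0 \<le> ?c"
    using isoperimetric_const_nonneg[of E] by simp
  have nb: "finite (neighbors E v)" for v
    using E(3) by (simp add: regular_graph_def)
  have "symp E"
    using E(1) by (simp add: simple_graph_def)
  have F_v: "(\<lambda>z. F z v) \<in> P \<rightarrow>\<^sub>M count_space S" for v
    using measurable_compose[OF F measurable_component_singleton[of v UNIV "\<lambda>_. count_space S"]] by simp
  have sf: "simple_function P (\<lambda>z. F z v)" for v
    using F_v \<open>finite S\<close> by (rule simple_function_count_space_finite)
  have X: "simple_function M (X v)" for v
    unfolding X_def using simple_function_seeds[OF sf] .
  have approx: "?c * (\<H>(X u) - e) \<le> ?R" if "0 < e" for e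
  proof -
    obtain q D0 where q: "finite_coding unit_interval q" and "finite D0"
      and D0: "\<And>D. finite D \<Longrightarrow> D0 \<subseteq> D \<Longrightarrow>
        \<H>(\<lambda>\<omega>. (X u \<omega>, readout q D (\<lambda>v. Z v \<omega>))) - \<H>(\<lambda>\<omega>. readout q D (\<lambda>v. Z v \<omega>)) \<le> e"
      using entropy_given_readout_small[OF F_v[of u] \<open>finite S\<close> \<open>0 < e\<close>] unfolding X_def by blast
    obtain n where n: "D0 \<subseteq> graph_ball E n u"
      using finite_subset_graph_ball[OF E(2) \<open>finite D0\<close>] by blast
    interpret coded_seeds M b Z q
      by unfold_locales (rule q)
    define f where "f k v = shapley (X v) (graph_ball E n v) k" for k v
    define m where "m k v = (\<Sum>w\<in>neighbors E v. max (f k v) (f k w))" for k v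
    \<comment> \<open>One step more than the window radius, to contain the neighbours of every vertex with a positive share.\<close>
    define A where "A = graph_ball E (Suc n) u"
    have ball: "finite (graph_ball E i v)" for i v
      using finite_graph_ball[OF nb] .
    then have A: "finite A"
      by (simp add: A_def)
    have f0: "0 \<le> f k v" for k v
      unfolding f_def by (rule shapley_nonneg[OF X ball])
    have m0: "0 \<le> m k v" for k v
      unfolding m_def using f0 by (intro sum_nonneg) (simp add: le_max_iff_disj)
    have supp: "k \<in> graph_ball E n v" if "f k v \<noteq> 0" for k v
      using that by (simp add: f_def shapley_def split: if_splits)
    have supp': "v \<in> graph_ball E n k" if "f k v \<noteq> 0" for k v
      using supp[OF that] graph_ball_commute[OF \<open>symp E\<close>] by blast
    have ball_A: "graph_ball E n u \<subseteq> A"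
      unfolding A_def by (rule graph_ball_mono) simp
    have step: "y \<in> A" if "x \<in> graph_ball E n u" "E x y" for x y
      unfolding A_def using graph_ball_Suc[OF that] .
    have step': "y \<in> A" if "y \<in> graph_ball E n x" "E u x" for x y
    proof -
      have "u \<in> graph_ball E (Suc n) y"
        using that \<open>symp E\<close> graph_ball_commute[OF \<open>symp E\<close>]
        by (intro graph_ball_Suc[of x]) (auto dest: sympD)
      then show ?thesis
        unfolding A_def using graph_ball_commute[OF \<open>symp E\<close>] by blast
    qed
    have f_out: "f u v = 0 \<and> f v u = 0" if "v \<notin> A" for v
      using that supp supp' ball_A by blast
    have m_out: "m u v = 0 \<and> m v u = 0" if "v \<notin> A" for v
    proof -
      have "f u w = 0" if "w \<in> neighbors E v" for w
        using supp'[of u w] step[of w v] \<open>v \<notin> A\<close> that \<open>symp E\<close>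
        by (auto simp: neighbors_def dest: sympD)
      moreover have "f v w = 0" if "w \<in> neighbors E u" for w
        using supp[of v w] step'[of v w] \<open>v \<notin> A\<close> that by (auto simp: neighbors_def)
      ultimately show ?thesis
        using f_out[OF that] by (simp add: m_def)
    qed
    have f_inv: "f (\<phi> k) (\<phi> v) = f k v" if "\<phi> \<in> Aut E" for \<phi> k v
    proof -
      have "bij \<phi>"
        using that by (simp add: Aut_def)
      \<comment> \<open>Equivariance is applied to the inverse of \<open>\<phi>\<close>, because \<open>shift\<close> pulls configurations back
        along the inverse.\<close>
      have X_\<phi>: "X (\<phi> v) \<omega> = F (\<lambda>w. Z (\<phi> w) \<omega>) v" if \<omega>: "\<omega> \<in> space M" for \<omega>
      proof -
        have "(\<lambda>w. Z w \<omega>) \<in> UNIV \<rightarrow> {0..1}"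
          using measurable_space[OF measurable_Z \<omega>] by (auto simp: unit_interval_def space_restrict_space)
        then have "F (shift (inv \<phi>) (\<lambda>w. Z w \<omega>)) = shift (inv \<phi>) (F (\<lambda>w. Z w \<omega>))"
          using equiv inv_in_Aut[OF \<open>\<phi> \<in> Aut E\<close>] unfolding equivariant_on_def by blast
        then show ?thesis
          using \<open>bij \<phi>\<close> by (simp add: shift_def inv_inv_eq X_def fun_eq_iff)
      qed
      have "f (\<phi> k) (\<phi> v) = shapley (X (\<phi> v)) (\<phi> ` graph_ball E n v) (\<phi> k)"
        by (simp add: f_def graph_ball_Aut[OF that])
      also have "\<dots> = shapley (\<lambda>\<omega>. F (\<lambda>w. Z (\<phi> w) \<omega>) v) (\<phi> ` graph_ball E n v) (\<phi> k)"
        using ball by (intro shapley_cong X simple_function_seeds[OF sf] X_\<phi>) auto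
      also have "\<dots> = shapley (\<lambda>\<omega>. F (\<lambda>w. Z w \<omega>) v) (graph_ball E n v) k"
        by (rule shapley_permute[OF sf \<open>bij \<phi>\<close> ball])
      finally show ?thesis
        by (simp add: f_def X_def)
    qed
    have m_inv: "m (\<phi> k) (\<phi> v) = m k v" if "\<phi> \<in> Aut E" for \<phi> k v
    proof -
      have "inj_on \<phi> (neighbors E v)"
        using that by (auto simp: Aut_def bij_def intro: inj_on_subset)
      then show ?thesis
        by (simp add: m_def neighbors_Aut[OF that] sum.reindex f_inv[OF that])
    qed
    have "\<H>(X u) - e \<le> (\<Sum>k\<in>graph_ball E n u. f k u)"
      using D0[OF ball n] sum_shapley[OF X[of u] ball[of n u]]
      by (simp add: f_def obs_def[abs_def])
    also have "\<dots> = (\<Sum>k\<in>A. f k u)"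
      using supp A ball_A by (intro sum.mono_neutral_left) auto
    also have "\<dots> = (\<Sum>v\<in>A. f u v)"
      using mass_transport_finite[of E f A u, OF E(4) f0 f_inv A f_out] by simp
    finally have "?c * (\<H>(X u) - e) \<le> ?c * (\<Sum>v\<in>A. f u v)"
      using c by (rule mult_left_mono)
    also have "\<dots> \<le> (\<Sum>v\<in>A. m u v)"
      unfolding m_def using supp' ball_A step
      by (intro isoperimetric_sum_max[OF E(1,3) A f0]) blast+
    also have "\<dots> = (\<Sum>k\<in>A. m k u)"
      by (rule mass_transport_finite[of E m A u, OF E(4) m0 m_inv A m_out])
    also have "\<dots> = (\<Sum>w\<in>neighbors E u. \<Sum>k\<in>A. max (f k u) (f k w))"
      unfolding m_def by (rule sum.swap)
    also have "\<dots> \<le> ?R"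
    proof (intro sum_mono)
      fix w assume w: "w \<in> neighbors E u"
      have "(\<Sum>k\<in>A. max (f k u) (f k w)) =
          (\<Sum>k\<in>graph_ball E n u \<union> graph_ball E n w. max (f k u) (f k w))"
      proof (intro sum.mono_neutral_right A ballI)
        show "graph_ball E n u \<union> graph_ball E n w \<subseteq> A"
          using ball_A step' w by (auto simp: neighbors_def)
        fix k assume "k \<in> A - (graph_ball E n u \<union> graph_ball E n w)"
        then have "f k u = 0" "f k w = 0"
          using supp by blast+
        then show "max (f k u) (f k w) = 0"
          by simp
      qed
      also have "\<dots> \<le> \<H>(\<lambda>\<omega>. (X u \<omega>, X w \<omega>))"
        unfolding f_def by (rule sum_max_shapley_le_entropy_Pair[OF X X ball ball])
      finally show "(\<Sum>k\<in>A. max (f k u) (f k w)) \<le> \<H>(\<lambda>\<omega>. (X u \<omega>, X w \<omega>))" .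
    qed
    finally show ?thesis .
  qed
  show ?thesis
  proof (rule field_le_epsilon)
    fix e :: real assume "0 < e"
    \<comment> \<open>The error in the entropy is multiplied by \<open>?c\<close>, which may be zero.\<close>
    then have "0 < e / (?c + 1)"
      using c by simp
    from approx[OF this] have "?c * \<H>(X u) \<le> ?R + ?c / (?c + 1) * e"
      by (simp add: right_diff_distrib)
    also have "?c / (?c + 1) * e \<le> 1 * e"
      using c \<open>0 < e\<close> by (intro mult_right_mono) auto
    finally show "?c * \<H>(X u) \<le> ?R + e"
      by simp
  qed
qed

theorem theorem2:
  fixes E :: "'v \<Rightarrow> 'v \<Rightarrow> bool" and d :: nat
    and M :: "'w measure" and b :: real
    and S :: "'s set" and X :: "'v \<Rightarrow> 'w \<Rightarrow> 's" and u :: 'v and \<beta> :: real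
  assumes "infinite (UNIV :: 'v set)"
    and "simple_graph E" and "connected_graph E" and "regular_graph E d"
    and "transitive_graph E" and "unimodular_graph E"
    and "information_space M b"
    and "finite S" and "factor_of_iid E M S X"
  defines "\<beta> \<equiv> (1 / 2) * (real d + isoperimetric_const E)"
  shows "(1 / 2) * (\<Sum>v\<in>neighbors E u. shannon_entropy M b (\<lambda>\<omega>. (X u \<omega>, X v \<omega>)))
    \<ge> \<beta> * shannon_entropy M b (X u)"
proof -
  obtain Z :: "'v \<Rightarrow> 'w \<Rightarrow> real" and F where
    Z: "prob_space.indep_vars M (\<lambda>_. unit_interval) Z UNIV"
      "\<And>v. distr M unit_interval (Z v) = unit_interval"
    and F: "F \<in> (\<Pi>\<^sub>M v\<in>UNIV. unit_interval) \<rightarrow>\<^sub>M (\<Pi>\<^sub>M v\<in>UNIV. count_space S)"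
      "equivariant_on E (UNIV \<rightarrow> {0..1}) F"
    and X: "\<And>\<omega> v. \<omega> \<in> space M \<Longrightarrow> X v \<omega> = F (\<lambda>u. Z u \<omega>) v"
    using assms(9) unfolding factor_of_iid_def by blast
  interpret information_space M b
    by (rule assms(7))
  interpret uniform_seeds M b Z
    by unfold_locales (use Z in auto)
  have F_v: "(\<lambda>z. F z v) \<in> P \<rightarrow>\<^sub>M count_space S" for v
    using measurable_compose[OF F(1) measurable_component_singleton[of v UNIV "\<lambda>_. count_space S"]] by simp
  have sf: "simple_function M (\<lambda>\<omega>. F (\<lambda>u. Z u \<omega>) v)" for v
    using simple_function_seeds[OF simple_function_count_space_finite[OF F_v assms(8)]] .
  have "\<H>(X u) = \<H>(\<lambda>\<omega>. F (\<lambda>u. Z u \<omega>) u)"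
    by (rule entropy_recode[OF sf, where f = "\<lambda>y. y"]) (simp_all add: X)
  moreover have "\<H>(\<lambda>\<omega>. (X u \<omega>, X v \<omega>)) = \<H>(\<lambda>\<omega>. (F (\<lambda>u. Z u \<omega>) u, F (\<lambda>u. Z u \<omega>) v))" for v
    by (rule entropy_recode[OF simple_function_Pair[OF sf sf], where f = "\<lambda>y. y"]) (simp_all add: X)
  ultimately show ?thesis
    using entropy_edges_of_factor_ge[OF assms(2,3,4,6,8) F, of u] by (simp add: \<beta>_def)
qed

end
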